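(* Let $G$ be a Lie group of dimension $n\ge2$ with Lie algebra $\mathfrak g$, $g$ a left-invariant pseudo-Riemannian metric, $H\in\bigwedge^3\mathfrak g^*$ a closed left-invariant three-form and $\delta\in E^*$. The components $R^\delta_{ia}=Ric^+_\delta(e_i,e_a)$ and $R^\delta_{ai}=Ric^-_\delta(e_a,e_i)$ ($a\in\{1,\dots,n\}$, $i\in\{n+1,\dots,2n\}$) of the Ricci curvatures of $(G,H,\mathcal G_g,\delta)$ are $$R^\delta_{ia}=\mathcal B_{bi}^j\mathcal B_{aj}^b+\mathcal B_{ia}^c\delta_c,\qquad R^\delta_{ai}=\mathcal B_{bi}^j\mathcal B_{aj}^b+\mathcal B_{ai}^j\delta_j,$$ with summation over repeated indices, $b,c$ ranging over $\{1,\dots,n\}$ and $j$ over $\{n+1,\dots,2n\}$. In particular, the Ricci tensor $Ric_\delta=Ric^+_\delta\oplus Ric^-_\delta$ is symmetric if and only if $\mathcal B_{ia}^c\delta_c=\mathcal B_{ai}^j\delta_j$ for all $a,i$. It is skew-symmetric if $(G,H,\mathcal G_g,0)$ is generalized Einstein (i.e. $Ric_0=0$) and $\mathcal B_{ia}^c\delta_c=-\mathcal B_{ai}^j\delta_j$ for all $a,i$. Moreover, for all $u_\pm\in E_\pm$, with $\Gamma_{u_+}=\mathrm{pr}_{E_+}\circ[u_+,\cdot]_H|_{E_-}:E_-\to E_+$ and $\Gamma_{u_-}=\mathrm{pr}_{E_-}\circ[u_-,\cdot]_H|_{E_+}:E_+\to E_-$, $$Ric^+_\delta(u_-,u_+)=-\mathrm{tr}(\Gamma_{u_-}\circ\Gamma_{u_+})+\delta(\mathrm{pr}_{E_+}[u_-,u_+]_H),$$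 $$Ric^-_\delta(u_+,u_-)=-\mathrm{tr}(\Gamma_{u_-}\circ\Gamma_{u_+})+\delta(\mathrm{pr}_{E_-}[u_+,u_-]_H).$$
   Context: Let $E=\mathfrak g\oplus\mathfrak g^*$, with scalar product $\langle X+\xi,Y+\eta\rangle=\frac12(\xi(Y)+\eta(X))$ and Dorfman bracket $[X+\xi,Y+\eta]_H=[X,Y]-\mathrm{ad}_X^*\eta+\mathrm{ad}_Y^*\xi+H(X,Y,\cdot)$, where $\mathrm{ad}_X^*\eta=\eta\circ\mathrm{ad}_X$. The metric $g$ is identified with a non-degenerate symmetric bilinear form on $\mathfrak g$; $gX=g(X,\cdot)$; $\mathcal G_g(X+\xi,Y+\eta)=\frac12(g(X,Y)+g^{-1}(\xi,\eta))$; $E_\pm=\{X\pm gX:X\in\mathfrak g\}$; $\mathrm{pr}_{E_\pm}$ are the projections of $E=E_+\oplus E_-$. Let $(v_1,\dots,v_n)$ be a $g$-orthonormal basis of $\mathfrak g$, $e_a=v_a+gv_a$ and $e_{n+a}=v_a-gv_a$ for $a=1,\dots,n$; $(e_a)$ is a basis of $E_+$ and $(e_i)_{i=n+1,\dots,2n}$ of $E_-$. The coefficients $\mathcal B_{AB}^C$, $A,B,C\in\{1,\dots,2n\}$, are defined by $[e_A,e_B]_H=\sum_C\mathcal B_{AB}^Ce_C$, and $\delta_A=\delta(e_A)$. A left-invariant generalized connection is a linear map $D:E\to\mathfrak{so}(E)$, $u\mapsto D_u$. Its torsion is $T(u,v)=D_uv-D_vu-[u,v]_H+(Du)^*v$,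 where $Du$ is $w\mapsto D_wu$ and $*$ is the adjoint for $\langle\cdot,\cdot\rangle$. $D$ is Levi-Civita if $T=0$ and $D_uE_\pm\subset E_\pm$ for all $u$. Its divergence is $\delta_D(v)=\mathrm{tr}(u\mapsto D_uv)$. Given $\delta\in E^*$, choose a Levi-Civita $D$ with $\delta_D=\delta$ (one exists if $n\ge2$), put $R(u,v)w=D_uD_vw-D_vD_uw-D_{[u,v]_H}w$ and, for $u_\pm\in E_\pm$, $Ric^+_\delta(u_-,u_+)=\mathrm{tr}(E_+\ni w\mapsto R(w,u_-)u_+\in E_+)$, $Ric^-_\delta(u_+,u_-)=\mathrm{tr}(E_-\ni w\mapsto R(w,u_+)u_-\in E_-)$; these are known to be independent of the choice of $D$. $Ric_\delta$ is regarded as a bilinear form on $E$ vanishing on $E_+\times E_+$ and $E_-\times E_-$. *)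

theory Defs
  imports "HOL-Analysis.Analysis"
begin

text \<open>
  The Lie algebra is a bracket on a type of class \<open>euclidean_space\<close>. The class only provides a
  finite-dimensional real vector space on which every linear functional is bounded, so that
  \<open>'a \<Rightarrow>\<^sub>L real\<close> is the full dual space; its inner product plays no role. \<open>Blinfun\<close> turns a linear
  functional given as a function into an element of the dual.
\<close>

type_synonym 'a double = "'a \<times> ('a \<Rightarrow>\<^sub>L real)"

definition lie_bracket :: "('a::real_vector \<Rightarrow> 'a \<Rightarrow> 'a) \<Rightarrow> bool" where
  "lie_bracket br \<longleftrightarrow> bilinear br \<and> (\<forall>x. br x x = 0) \<and>
     (\<forall>x y z. br x (br y z) + br y (br z x) + br z (br x y) = 0)"

definition three_form :: "('a::real_vector \<Rightarrow> 'a \<Rightarrow> 'a \<Rightarrow> real) \<Rightarrow> bool" where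
  "three_form H \<longleftrightarrow>
     (\<forall>x y. linear (\<lambda>z. H x y z)) \<and> (\<forall>x z. linear (\<lambda>y. H x y z)) \<and> (\<forall>y z. linear (\<lambda>x. H x y z)) \<and>
     (\<forall>x y. H x x y = 0 \<and> H x y x = 0 \<and> H y x x = 0)"

text \<open>
  The exterior derivative of a left-invariant three-form, evaluated on left-invariant fields
  (Chevalley--Eilenberg differential): \<open>\<Sum>\<close> over \<open>i < j\<close> of
  \<open>(-1)\<close> to the power \<open>i + j\<close> times \<open>H([x\<^sub>i, x\<^sub>j], \<dots>)\<close>.
\<close>

definition ext_deriv3 ::
  "('a::real_vector \<Rightarrow> 'a \<Rightarrow> 'a) \<Rightarrow> ('a \<Rightarrow> 'a \<Rightarrow> 'a \<Rightarrow> real) \<Rightarrow> 'a \<Rightarrow> 'a \<Rightarrow> 'a \<Rightarrow> 'a \<Rightarrow> real" where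
  "ext_deriv3 br H x0 x1 x2 x3 =
     - H (br x0 x1) x2 x3 + H (br x0 x2) x1 x3 - H (br x0 x3) x1 x2
     - H (br x1 x2) x0 x3 + H (br x1 x3) x0 x2 - H (br x2 x3) x0 x1"

definition closed_three_form ::
  "('a::real_vector \<Rightarrow> 'a \<Rightarrow> 'a) \<Rightarrow> ('a \<Rightarrow> 'a \<Rightarrow> 'a \<Rightarrow> real) \<Rightarrow> bool" where
  "closed_three_form br H \<longleftrightarrow>
     three_form H \<and> (\<forall>x0 x1 x2 x3. ext_deriv3 br H x0 x1 x2 x3 = 0)"

definition pseudo_metric :: "('a::real_vector \<Rightarrow> 'a \<Rightarrow> real) \<Rightarrow> bool" where
  "pseudo_metric g \<longleftrightarrow> bilinear g \<and> (\<forall>x y. g x y = g y x) \<and>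
     (\<forall>x. (\<forall>y. g x y = 0) \<longrightarrow> x = 0)"

text \<open>Orthonormality is in the pseudo-Riemannian sense: \<open>g(v\<^sub>a, v\<^sub>a)\<close> may be \<open>1\<close> or \<open>-1\<close>.\<close>

definition orthonormal_basis ::
  "('a::real_vector \<Rightarrow> 'a \<Rightarrow> real) \<Rightarrow> nat \<Rightarrow> (nat \<Rightarrow> 'a) \<Rightarrow> bool" where
  "orthonormal_basis g n v \<longleftrightarrow>
     inj_on v {1..n} \<and> independent (v ` {1..n}) \<and> span (v ` {1..n}) = UNIV \<and>
     (\<forall>a\<in>{1..n}. \<forall>b\<in>{1..n}. a \<noteq> b \<longrightarrow> g (v a) (v b) = 0) \<and>
     (\<forall>a\<in>{1..n}. \<bar>g (v a) (v a)\<bar> = 1)"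

text \<open>
  Trace of an endomorphism of the finite-dimensional subspace \<open>V\<close>; only the values of \<open>f\<close> on \<open>V\<close>
  matter, and \<open>f\<close> should map \<open>V\<close> linearly into itself.
\<close>

definition trace_on :: "'v::real_vector set \<Rightarrow> ('v \<Rightarrow> 'v) \<Rightarrow> real" where
  "trace_on V f =
     (let B = (SOME B. B \<subseteq> V \<and> independent B \<and> V \<subseteq> span B) in \<Sum>b\<in>B. representation B (f b) b)"

definition pairing :: "'a::euclidean_space double \<Rightarrow> 'a double \<Rightarrow> real" where
  "pairing u v =
     (blinfun_apply (snd u) (fst v) + blinfun_apply (snd v) (fst u)) / 2"

definition pairing_adjoint ::
  "('a::euclidean_space double \<Rightarrow> 'a double) \<Rightarrow> 'a double \<Rightarrow> 'a double" where
  "pairing_adjoint A = (THE A'. \<forall>u v. pairing (A u) v = pairing u (A' v))"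

definition coad :: "('a::euclidean_space \<Rightarrow> 'a \<Rightarrow> 'a) \<Rightarrow> 'a \<Rightarrow> ('a \<Rightarrow>\<^sub>L real) \<Rightarrow> ('a \<Rightarrow>\<^sub>L real)" where
  "coad br x \<eta> = Blinfun (\<lambda>z. blinfun_apply \<eta> (br x z))"

definition dorfman ::
  "('a::euclidean_space \<Rightarrow> 'a \<Rightarrow> 'a) \<Rightarrow> ('a \<Rightarrow> 'a \<Rightarrow> 'a \<Rightarrow> real) \<Rightarrow> 'a double \<Rightarrow> 'a double \<Rightarrow> 'a double" where
  "dorfman br H u v =
     (br (fst u) (fst v),
      - coad br (fst u) (snd v) + coad br (fst v) (snd u) + Blinfun (H (fst u) (fst v)))"

definition flat :: "('a::euclidean_space \<Rightarrow> 'a \<Rightarrow> real) \<Rightarrow> 'a \<Rightarrow> ('a \<Rightarrow>\<^sub>L real)" where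
  "flat g x = Blinfun (g x)"

text \<open>
  The generalized metric of \<open>g\<close> enters only through these subspaces, the eigenspaces for \<open>1\<close> and
  \<open>-1\<close> of the endomorphism it defines by means of \<open>pairing\<close>.
\<close>

definition E_plus :: "('a::euclidean_space \<Rightarrow> 'a \<Rightarrow> real) \<Rightarrow> 'a double set" where
  "E_plus g = range (\<lambda>x. (x, flat g x))"

definition E_minus :: "('a::euclidean_space \<Rightarrow> 'a \<Rightarrow> real) \<Rightarrow> 'a double set" where
  "E_minus g = range (\<lambda>x. (x, - flat g x))"

definition pr_plus :: "('a::euclidean_space \<Rightarrow> 'a \<Rightarrow> real) \<Rightarrow> 'a double \<Rightarrow> 'a double" where
  "pr_plus g u = (THE w. w \<in> E_plus g \<and> u - w \<in> E_minus g)"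

definition pr_minus :: "('a::euclidean_space \<Rightarrow> 'a \<Rightarrow> real) \<Rightarrow> 'a double \<Rightarrow> 'a double" where
  "pr_minus g u = (THE w. w \<in> E_minus g \<and> u - w \<in> E_plus g)"

definition frame ::
  "('a::euclidean_space \<Rightarrow> 'a \<Rightarrow> real) \<Rightarrow> nat \<Rightarrow> (nat \<Rightarrow> 'a) \<Rightarrow> nat \<Rightarrow> 'a double" where
  "frame g n v A =
     (if A \<le> n then (v A, flat g (v A)) else (v (A - n), - flat g (v (A - n))))"

definition gen_connection ::
  "('a::euclidean_space double \<Rightarrow> 'a double \<Rightarrow> 'a double) \<Rightarrow> bool" where
  "gen_connection D \<longleftrightarrow> bilinear D \<and>
     (\<forall>u v w. pairing (D u v) w + pairing v (D u w) = 0)"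

definition torsion ::
  "('a::euclidean_space \<Rightarrow> 'a \<Rightarrow> 'a) \<Rightarrow> ('a \<Rightarrow> 'a \<Rightarrow> 'a \<Rightarrow> real) \<Rightarrow>
   ('a double \<Rightarrow> 'a double \<Rightarrow> 'a double) \<Rightarrow> 'a double \<Rightarrow> 'a double \<Rightarrow> 'a double" where
  "torsion br H D u v =
     D u v - D v u - dorfman br H u v + pairing_adjoint (\<lambda>w. D w u) v"

definition levi_civita ::
  "('a::euclidean_space \<Rightarrow> 'a \<Rightarrow> 'a) \<Rightarrow> ('a \<Rightarrow> 'a \<Rightarrow> 'a \<Rightarrow> real) \<Rightarrow> ('a \<Rightarrow> 'a \<Rightarrow> real) \<Rightarrow>
   ('a double \<Rightarrow> 'a double \<Rightarrow> 'a double) \<Rightarrow> bool" where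
  "levi_civita br H g D \<longleftrightarrow> gen_connection D \<and>
     (\<forall>u v. torsion br H D u v = 0) \<and>
     (\<forall>u. D u ` E_plus g \<subseteq> E_plus g \<and> D u ` E_minus g \<subseteq> E_minus g)"

definition divergence ::
  "('a::euclidean_space double \<Rightarrow> 'a double \<Rightarrow> 'a double) \<Rightarrow> 'a double \<Rightarrow> real" where
  "divergence D v = trace_on UNIV (\<lambda>u. D u v)"

definition curvature ::
  "('a::euclidean_space \<Rightarrow> 'a \<Rightarrow> 'a) \<Rightarrow> ('a \<Rightarrow> 'a \<Rightarrow> 'a \<Rightarrow> real) \<Rightarrow>
   ('a double \<Rightarrow> 'a double \<Rightarrow> 'a double) \<Rightarrow> 'a double \<Rightarrow> 'a double \<Rightarrow> 'a double \<Rightarrow> 'a double" where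
  "curvature br H D u v w = D u (D v w) - D v (D u w) - D (dorfman br H u v) w"

text \<open>
  A Levi-Civita connection with divergence \<open>\<delta>\<close>. One exists when the dimension is at least two and
  \<open>\<delta>\<close> is linear; the Ricci curvatures below do not depend on which one is chosen.
\<close>

definition chosen_connection ::
  "('a::euclidean_space \<Rightarrow> 'a \<Rightarrow> 'a) \<Rightarrow> ('a \<Rightarrow> 'a \<Rightarrow> 'a \<Rightarrow> real) \<Rightarrow> ('a \<Rightarrow> 'a \<Rightarrow> real) \<Rightarrow>
   ('a double \<Rightarrow> real) \<Rightarrow> 'a double \<Rightarrow> 'a double \<Rightarrow> 'a double" where
  "chosen_connection br H g \<delta> = (SOME D. levi_civita br H g D \<and> divergence D = \<delta>)"

definition Ric_plus ::
  "('a::euclidean_space \<Rightarrow> 'a \<Rightarrow> 'a) \<Rightarrow> ('a \<Rightarrow> 'a \<Rightarrow> 'a \<Rightarrow> real) \<Rightarrow> ('a \<Rightarrow> 'a \<Rightarrow> real) \<Rightarrow>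
   ('a double \<Rightarrow> real) \<Rightarrow> 'a double \<Rightarrow> 'a double \<Rightarrow> real" where
  "Ric_plus br H g \<delta> um up =
     trace_on (E_plus g) (\<lambda>w. curvature br H (chosen_connection br H g \<delta>) w um up)"

definition Ric_minus ::
  "('a::euclidean_space \<Rightarrow> 'a \<Rightarrow> 'a) \<Rightarrow> ('a \<Rightarrow> 'a \<Rightarrow> 'a \<Rightarrow> real) \<Rightarrow> ('a \<Rightarrow> 'a \<Rightarrow> real) \<Rightarrow>
   ('a double \<Rightarrow> real) \<Rightarrow> 'a double \<Rightarrow> 'a double \<Rightarrow> real" where
  "Ric_minus br H g \<delta> up um =
     trace_on (E_minus g) (\<lambda>w. curvature br H (chosen_connection br H g \<delta>) w up um)"

definition Ric ::
  "('a::euclidean_space \<Rightarrow> 'a \<Rightarrow> 'a) \<Rightarrow> ('a \<Rightarrow> 'a \<Rightarrow> 'a \<Rightarrow> real) \<Rightarrow> ('a \<Rightarrow> 'a \<Rightarrow> real) \<Rightarrow>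
   ('a double \<Rightarrow> real) \<Rightarrow> 'a double \<Rightarrow> 'a double \<Rightarrow> real" where
  "Ric br H g \<delta> u v =
     Ric_plus br H g \<delta> (pr_minus g u) (pr_plus g v) + Ric_minus br H g \<delta> (pr_plus g u) (pr_minus g v)"

definition generalized_einstein ::
  "('a::euclidean_space \<Rightarrow> 'a \<Rightarrow> 'a) \<Rightarrow> ('a \<Rightarrow> 'a \<Rightarrow> 'a \<Rightarrow> real) \<Rightarrow> ('a \<Rightarrow> 'a \<Rightarrow> real) \<Rightarrow>
   ('a double \<Rightarrow> real) \<Rightarrow> bool" where
  "generalized_einstein br H g \<delta> \<longleftrightarrow> (\<forall>u v. Ric br H g \<delta> u v = 0)"

text \<open>
  \<open>Gamma_plus\<close> is meant on \<open>E_minus\<close> (for \<open>u\<close> in \<open>E_plus\<close>), \<open>Gamma_minus\<close> on \<open>E_plus\<close> (for \<open>u\<close> in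
  \<open>E_minus\<close>).
\<close>

definition Gamma_plus ::
  "('a::euclidean_space \<Rightarrow> 'a \<Rightarrow> 'a) \<Rightarrow> ('a \<Rightarrow> 'a \<Rightarrow> 'a \<Rightarrow> real) \<Rightarrow> ('a \<Rightarrow> 'a \<Rightarrow> real) \<Rightarrow>
   'a double \<Rightarrow> 'a double \<Rightarrow> 'a double" where
  "Gamma_plus br H g u = (\<lambda>w. pr_plus g (dorfman br H u w))"

definition Gamma_minus ::
  "('a::euclidean_space \<Rightarrow> 'a \<Rightarrow> 'a) \<Rightarrow> ('a \<Rightarrow> 'a \<Rightarrow> 'a \<Rightarrow> real) \<Rightarrow> ('a \<Rightarrow> 'a \<Rightarrow> real) \<Rightarrow>
   'a double \<Rightarrow> 'a double \<Rightarrow> 'a double" where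
  "Gamma_minus br H g u = (\<lambda>w. pr_minus g (dorfman br H u w))"

end

theory Submission
  imports Defs
begin

text \<open>
  Vanishing torsion says that the cyclic sum of \<open>\<langle>D\<^sub>u v, w\<rangle>\<close> equals \<open>\<langle>[u, v], w\<rangle>\<close>, which is totally
  skew. As \<open>D\<close> preserves \<open>E\<^sub>\<plusminus>\<close>, this forces \<open>D\<^sub>x y = pr\<^sub>+ [x, y]\<close> for \<open>x\<close> in \<open>E\<^sub>-\<close>, \<open>y\<close> in \<open>E\<^sub>+\<close> (and likewise
  with the signs exchanged). In the trace of the curvature the part \<open>w \<mapsto> D\<^sub>x (D\<^sub>w y) - D\<^bsub>D\<^sub>x w\<^esub> y\<close> is a
  commutator of endomorphisms of \<open>E\<^sub>+\<close> and drops out; what is left are a divergence and the trace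
  of \<open>\<Gamma>\<^sub>x \<circ> \<Gamma>\<^sub>y\<close>.

  A Levi-Civita \<open>D\<close> with divergence \<open>\<delta> = \<langle>a, \<cdot>\<rangle>\<close> is obtained from a third of the bracket on the pure
  components by adding \<open>c (\<langle>u, v\<rangle> a - \<langle>a, v\<rangle> u)\<close>, which has vanishing cyclic sum and trace
  \<open>c (1 - n) \<langle>a, v\<rangle>\<close>. Replacing \<open>g\<close> by \<open>-g\<close> exchanges \<open>E\<^sub>+\<close> and \<open>E\<^sub>-\<close>, so only one sign is treated.
\<close>

subsection \<open>Traces on subspaces\<close>

text \<open>The basis picked by \<open>SOME\<close> depends on \<open>V\<close> alone, so one
  \<open>B\<close> serves all maps at once and their traces can be compared. The finite spanning set
  bounds \<open>B\<close> and so makes it finite.\<close>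

lemma trace_on_basis:
  fixes V :: "'v::real_vector set"
  assumes "finite S" "V \<subseteq> span S"
  obtains B where "B \<subseteq> V" "independent B" "V \<subseteq> span B" "finite B"
    "\<And>f. trace_on V f = (\<Sum>b\<in>B. representation B (f b) b)"
proof -
  define B where "B = (SOME B. B \<subseteq> V \<and> independent B \<and> V \<subseteq> span B)"
  have "\<exists>B. B \<subseteq> V \<and> independent B \<and> V \<subseteq> span B"
    using maximal_independent_subset by metis
  then have B: "B \<subseteq> V \<and> independent B \<and> V \<subseteq> span B"
    unfolding B_def by (rule someI_ex)
  moreover have "finite B"
    using independent_span_bound[of S B] assms B by auto
  moreover have "trace_on V f = (\<Sum>b\<in>B. representation B (f b) b)" for f
    by (simp add: trace_on_def Let_def B_def)
  ultimately show thesis using that by blast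
qed

lemma sum_representation_apply:
  assumes "independent B" "finite B" "x \<in> span B" "linear \<phi>"
  shows "(\<Sum>b\<in>B. representation B x b *\<^sub>R \<phi> b) = \<phi> x"
proof -
  have "\<phi> x = \<phi> (\<Sum>b\<in>B. representation B x b *\<^sub>R b)"
    using real_vector.sum_representation_eq[of B x B] assms by simp
  then show ?thesis
    using assms(4) by (simp add: linear_sum linear_scale)
qed

lemma representation_linear_image:
  fixes q :: "'c::real_vector \<Rightarrow> 'd::real_vector"
  assumes "independent B" "independent C" "finite C" "linear q" "q ` C \<subseteq> span B" "x \<in> span C"
  shows "representation B (q x) b = (\<Sum>c\<in>C. representation C x c * representation B (q c) b)"
proof -
  have "q x = (\<Sum>c\<in>C. representation C x c *\<^sub>R q c)"
    using sum_representation_apply assms by metis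
  then show ?thesis using assms
    by (auto simp: real_vector.representation_sum real_vector.representation_scale
        span_scale image_subset_iff)
qed

lemma trace_on_cong:
  assumes "finite S" "V \<subseteq> span S" "\<And>x. x \<in> V \<Longrightarrow> f x = h x"
  shows "trace_on V f = trace_on V h"
proof -
  obtain B where B: "B \<subseteq> V" "\<And>f. trace_on V f = (\<Sum>b\<in>B. representation B (f b) b)"
    using trace_on_basis[OF assms(1,2)] by metis
  show ?thesis unfolding B using B(1) assms(3) by (intro sum.cong) auto
qed

lemma trace_on_add:
  assumes "finite S" "V \<subseteq> span S" "f ` V \<subseteq> V" "h ` V \<subseteq> V"
  shows "trace_on V (\<lambda>x. f x + h x) = trace_on V f + trace_on V h"
proof -
  obtain B where B: "B \<subseteq> V" "independent B" "V \<subseteq> span B"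
      "\<And>f. trace_on V f = (\<Sum>b\<in>B. representation B (f b) b)"
    using trace_on_basis[OF assms(1,2)] by metis
  have "f b \<in> span B" "h b \<in> span B" if "b \<in> B" for b
    using that B assms by blast+
  then show ?thesis unfolding B(4) using B(2)
    by (simp add: real_vector.representation_add sum.distrib)
qed

lemma trace_on_diff:
  assumes "finite S" "V \<subseteq> span S" "f ` V \<subseteq> V" "h ` V \<subseteq> V"
  shows "trace_on V (\<lambda>x. f x - h x) = trace_on V f - trace_on V h"
proof -
  obtain B where B: "B \<subseteq> V" "independent B" "V \<subseteq> span B"
      "\<And>f. trace_on V f = (\<Sum>b\<in>B. representation B (f b) b)"
    using trace_on_basis[OF assms(1,2)] by metis
  have "f b \<in> span B" "h b \<in> span B" if "b \<in> B" for b
    using that B assms by blast+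
  then show ?thesis unfolding B(4) using B(2)
    by (simp add: real_vector.representation_diff sum_subtractf)
qed

lemma trace_on_zero: "trace_on V (\<lambda>_. 0) = 0"
  by (simp add: trace_on_def real_vector.representation_zero)

text \<open>In bases \<open>B\<close> of \<open>V\<close> and \<open>C\<close> of \<open>W\<close>
  both traces are the same double sum of products of matrix entries, summed in opposite orders.
  Letting \<open>V\<close> and \<open>W\<close> differ covers inclusions and maps between
  \<open>E_plus\<close> and \<open>E_minus\<close>.\<close>

lemma trace_on_comp_swap:
  assumes V: "finite S" "V \<subseteq> span S" and W: "finite T" "W \<subseteq> span T"
    and lin: "linear f" "linear h" and f: "f ` V \<subseteq> W" and h: "h ` W \<subseteq> V"
  shows "trace_on V (h \<circ> f) = trace_on W (f \<circ> h)"
proof -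
  obtain B where B: "B \<subseteq> V" "independent B" "V \<subseteq> span B" "finite B"
      "\<And>f. trace_on V f = (\<Sum>b\<in>B. representation B (f b) b)"
    using trace_on_basis[OF V] by metis
  obtain C where C: "C \<subseteq> W" "independent C" "W \<subseteq> span C" "finite C"
      "\<And>f. trace_on W f = (\<Sum>b\<in>C. representation C (f b) b)"
    using trace_on_basis[OF W] by metis
  have hB: "h ` C \<subseteq> span B" and fC: "f ` B \<subseteq> span C"
    using B(1,3) C(1,3) f h by blast+
  have "representation B (h (f b)) b = (\<Sum>c\<in>C. representation C (f b) c * representation B (h c) b)"
    if "b \<in> B" for b
    using hB fC that B(2) C(2,4) lin by (intro representation_linear_image) auto
  moreover have "representation C (f (h c)) c = (\<Sum>b\<in>B. representation B (h c) b * representation C (f b) c)"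
    if "c \<in> C" for c
    using hB fC that C(2) B(2,4) lin by (intro representation_linear_image) auto
  ultimately show ?thesis
    unfolding B(5) C(5) comp_def
    by (simp, subst sum.swap, simp add: mult.commute)
qed

text \<open>Swaps \<open>f\<close>, seen as a map from the whole space to \<open>V\<close>, with the
  inclusion of \<open>V\<close>.\<close>

lemma trace_on_subspace:
  fixes S T :: "'v::real_vector set"
  assumes "finite S" "V \<subseteq> span S" "finite T" "UNIV \<subseteq> span T" "linear f" "range f \<subseteq> V"
  shows "trace_on UNIV f = trace_on V f"
  using trace_on_comp_swap[OF assms(3,4,1,2) assms(5) linear_id] assms(6) by simp

text \<open>\<open>e\<close> and \<open>\<phi>\<close> form a resolution of the identity on
  \<open>V\<close>. Expanding \<open>f b\<close> in it and exchanging the sums leaves, for each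
  \<open>i\<close>, the coordinates of \<open>e i\<close> in \<open>B\<close>, against which
  \<open>\<phi> i \<circ> f\<close> recombines to its value at \<open>e i\<close>. This evaluates in
  a frame a trace defined by an unknown basis.\<close>

lemma trace_on_eq_sum:
  assumes S: "finite S" "V \<subseteq> span S" and "linear f" "f ` V \<subseteq> V"
    and e: "\<And>i. i \<in> I \<Longrightarrow> e i \<in> V" and \<phi>: "\<And>i. i \<in> I \<Longrightarrow> linear (\<phi> i)"
    and expand: "\<And>x. x \<in> V \<Longrightarrow> x = (\<Sum>i\<in>I. \<phi> i x *\<^sub>R e i)"
  shows "trace_on V f = (\<Sum>i\<in>I. \<phi> i (f (e i)))"
proof -
  obtain B where B: "B \<subseteq> V" "independent B" "V \<subseteq> span B" "finite B"
      "\<And>f. trace_on V f = (\<Sum>b\<in>B. representation B (f b) b)"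
    using trace_on_basis[OF S] by metis
  have "representation B (f b) b = (\<Sum>i\<in>I. \<phi> i (f b) * representation B (e i) b)" if "b \<in> B" for b
  proof -
    have "f b \<in> V" using that B(1) assms(4) by blast
    have "representation B (\<Sum>i\<in>I. \<phi> i (f b) *\<^sub>R e i) b = (\<Sum>i\<in>I. \<phi> i (f b) * representation B (e i) b)"
      using B e by (subst real_vector.representation_sum)
        (auto simp: real_vector.representation_scale span_scale subset_iff)
    then show ?thesis using expand[OF \<open>f b \<in> V\<close>] by metis
  qed
  then have "trace_on V f = (\<Sum>i\<in>I. \<Sum>b\<in>B. representation B (e i) b *\<^sub>R (\<phi> i \<circ> f) b)"
    unfolding B(5) by (simp, subst sum.swap, simp add: mult.commute)
  also have "\<dots> = (\<Sum>i\<in>I. (\<phi> i \<circ> f) (e i))"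
    using B e assms(3) \<phi> by (intro sum.cong refl sum_representation_apply linear_compose) auto
  finally show ?thesis by simp
qed

subsection \<open>Duality\<close>

lemma blinfun_apply_Blinfun_linear:
  fixes f :: "'a::euclidean_space \<Rightarrow> real"
  shows "linear f \<Longrightarrow> blinfun_apply (Blinfun f) = f"
  by (simp add: bounded_linear_Blinfun_apply linear_conv_bounded_linear)

lemma bilinear_pairing: "bilinear pairing"
  unfolding bilinear_def pairing_def
  by (auto intro!: linearI simp: blinfun.bilinear_simps algebra_simps add_divide_distrib)

lemmas pairing_simps =
  bilinear_ladd[OF bilinear_pairing] bilinear_radd[OF bilinear_pairing]
  bilinear_lsub[OF bilinear_pairing] bilinear_rsub[OF bilinear_pairing]
  bilinear_lneg[OF bilinear_pairing] bilinear_rneg[OF bilinear_pairing]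
  bilinear_lmul[OF bilinear_pairing] bilinear_rmul[OF bilinear_pairing]
  bilinear_lzero[OF bilinear_pairing] bilinear_rzero[OF bilinear_pairing]

lemma linear_pairing: "linear (pairing u)"
  using bilinear_pairing unfolding bilinear_def by blast

lemma pairing_commute: "pairing u v = pairing v u"
  by (simp add: pairing_def)

lemma pairing_nondegenerate:
  fixes u :: "'a::euclidean_space double"
  assumes "\<And>w. pairing u w = 0"
  shows "u = 0"
proof -
  have "blinfun_apply (snd u) x = 0" for x
    using assms[of "(x, 0)"] by (simp add: pairing_def)
  then have "snd u = 0" by (auto intro: blinfun_eqI)
  \<comment> \<open>The covector given by the inner product with \<open>fst u\<close> kills
    \<open>fst u\<close> only if \<open>fst u = 0\<close>.\<close>
  have "fst u \<bullet> fst u = 0"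
    using assms[of "(0, blinfun_inner_right (fst u))"] by (simp add: pairing_def)
  with \<open>snd u = 0\<close> show ?thesis by (simp add: prod_eq_iff)
qed

lemma blinfun_eq_sum_Basis:
  fixes \<xi> :: "'a::euclidean_space \<Rightarrow>\<^sub>L real"
  shows "\<xi> = (\<Sum>b\<in>Basis. blinfun_apply \<xi> b *\<^sub>R blinfun_inner_right b)"
proof (rule blinfun_eqI)
  fix x
  have "blinfun_apply \<xi> x = blinfun_apply \<xi> (\<Sum>b\<in>Basis. (x \<bullet> b) *\<^sub>R b)"
    by (simp add: euclidean_representation)
  then show "blinfun_apply \<xi> x = blinfun_apply (\<Sum>b\<in>Basis. blinfun_apply \<xi> b *\<^sub>R blinfun_inner_right b) x"
    by (simp add: blinfun.bilinear_simps inner_commute mult.commute)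
qed

lemma pairing_representation:
  fixes \<phi> :: "'a::euclidean_space double \<Rightarrow> real"
  assumes "linear \<phi>"
  obtains a where "\<And>w. \<phi> w = pairing a w"
proof
  fix w :: "'a double"
  \<comment> \<open>The roles cross over: values of \<open>\<phi>\<close> on covectors give the
    vector part of the representative, values on vectors its covector part. The factors 2 cancel the
    1/2 in \<open>pairing\<close>.\<close>
  let ?a = "(2 *\<^sub>R (\<Sum>b\<in>Basis. \<phi> (0, blinfun_inner_right b) *\<^sub>R b), 2 *\<^sub>R Blinfun (\<lambda>x. \<phi> (x, 0)))"
  have lin: "linear (\<lambda>x. \<phi> (x, 0))" "linear (\<lambda>x. \<phi> (0, x))"
    using linear_compose[OF _ assms, of "\<lambda>x. (x, 0)"] linear_compose[OF _ assms, of "\<lambda>x. (0, x)"]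
    by (auto intro!: linearI simp: comp_def linear_iff)
  have "\<phi> (0, snd w) = (\<Sum>b\<in>Basis. blinfun_apply (snd w) b * \<phi> (0, blinfun_inner_right b))"
    using arg_cong[OF blinfun_eq_sum_Basis[of "snd w"], of "\<lambda>x. \<phi> (0, x)"]
    unfolding linear_sum[OF lin(2)] by (simp add: linear_scale[OF lin(2)])
  moreover have "\<phi> w = \<phi> (fst w, 0) + \<phi> (0, snd w)"
    by (simp flip: linear_add[OF assms])
  ultimately show "\<phi> w = pairing ?a w"
    using lin(1) by (simp add: pairing_def blinfun_apply_Blinfun_linear blinfun.bilinear_simps mult.commute)
qed

text \<open>Justifies the \<open>THE\<close> in \<open>pairing_adjoint\<close>: existence by
  representing, for each \<open>v\<close>, the functional that pairs \<open>v\<close> with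
  \<open>A u\<close>; uniqueness by nondegeneracy.\<close>

lemma pairing_adjoint_works:
  assumes "linear A"
  shows "pairing (A u) v = pairing u (pairing_adjoint A v)"
proof -
  have "\<exists>a. \<forall>u. pairing (A u) v = pairing u a" for v
  proof -
    have "linear (\<lambda>u. pairing v (A u))"
      using linear_compose[OF assms linear_pairing, of v] by (simp add: comp_def)
    then obtain a where "pairing v (A u) = pairing a u" for u
      using pairing_representation by blast
    then show ?thesis using pairing_commute by metis
  qed
  then obtain A' where A': "\<forall>u v. pairing (A u) v = pairing u (A' v)" by metis
  have "\<forall>u v. pairing (A u) v = pairing u (pairing_adjoint A v)"
    unfolding pairing_adjoint_def
  proof (rule theI[of _ A'])
    show "A'' = A'" if "\<forall>u v. pairing (A u) v = pairing u (A'' v)" for A''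
    proof
      fix v
      have "pairing (A'' v - A' v) u = 0" for u
      proof -
        have "pairing u (A'' v) = pairing u (A' v)" using that A' by metis
        then show ?thesis by (simp add: pairing_simps pairing_commute[of _ u])
      qed
      then show "A'' v = A' v" using pairing_nondegenerate by fastforce
    qed
  qed (rule A')
  then show ?thesis by blast
qed


text \<open>\<open>'a double\<close> is not an instance of \<open>euclidean_space\<close>, hence the explicit spanning set.\<close>

lemma double_finite_span:
  obtains S :: "'a::euclidean_space double set" where "finite S" "\<And>V. V \<subseteq> span S"
proof
  let ?S = "(\<lambda>b. (b, 0)) ` Basis \<union> (\<lambda>b. (0, blinfun_inner_right b)) ` Basis :: 'a double set"
  show "finite ?S" by simp
  show "V \<subseteq> span ?S" for V
  proof
    fix u :: "'a double"
    have "fst u = (\<Sum>b\<in>Basis. (fst u \<bullet> b) *\<^sub>R b)"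
      by (simp add: euclidean_representation)
    then have "u = (\<Sum>b\<in>Basis. (fst u \<bullet> b) *\<^sub>R (b, 0))
        + (\<Sum>b\<in>Basis. blinfun_apply (snd u) b *\<^sub>R (0, blinfun_inner_right b))"
      using blinfun_eq_sum_Basis[of "snd u"]
      by (simp add: prod_eq_iff fst_sum snd_sum)
    moreover have "\<dots> \<in> span ?S"
      by (intro span_add span_sum span_scale span_base) auto
    ultimately show "u \<in> span ?S" by simp
  qed
qed

lemma flat_surj:
  fixes g :: "'a::euclidean_space \<Rightarrow> 'a \<Rightarrow> real"
  assumes g: "bilinear g" and nondeg: "\<And>x. (\<forall>y. g x y = 0) \<Longrightarrow> x = 0"
  obtains z where "flat g z = \<xi>"
proof -
  have lin: "linear (g x)" "linear (\<lambda>x. g x y)" for x y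
    using g unfolding bilinear_def by blast+
  \<comment> \<open>\<open>flat g\<close> maps into the dual. Identifying the dual with the space
    itself by the inner product turns it into an endomorphism, for which injectivity gives
    surjectivity.\<close>
  define f where "f x = (\<Sum>b\<in>Basis. g x b *\<^sub>R b)" for x
  have f: "f x \<bullet> y = g x y" for x y
  proof -
    have "g x y = g x (\<Sum>b\<in>Basis. (y \<bullet> b) *\<^sub>R b)"
      by (simp add: euclidean_representation)
    also have "\<dots> = f x \<bullet> y"
      unfolding linear_sum[OF lin(1)] f_def
      by (simp add: linear_scale[OF lin(1)] inner_sum_left inner_commute[of y] mult.commute)
    finally show ?thesis by simp
  qed
  have "linear f"
    by (rule linearI; subst vector_eq_rdot[symmetric])
      (simp_all add: f inner_add_left linear_add[OF lin(2)] linear_scale[OF lin(2)])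
  moreover have "inj f"
    using nondeg f by (simp add: linear_injective_0[OF \<open>linear f\<close>]) (metis inner_zero_left)
  ultimately have "surj f" by (simp add: linear_injective_imp_surjective)
  then obtain z where z: "f z = (\<Sum>b\<in>Basis. blinfun_apply \<xi> b *\<^sub>R b)" by (metis surjD)
  have "blinfun_apply (flat g z) y = blinfun_apply \<xi> y" for y
  proof -
    have "blinfun_apply \<xi> y = (\<Sum>b\<in>Basis. blinfun_apply \<xi> b * (y \<bullet> b))"
      by (subst blinfun_eq_sum_Basis) (simp add: blinfun.bilinear_simps inner_commute)
    then show ?thesis
      by (simp add: flat_def blinfun_apply_Blinfun_linear lin flip: f)
        (simp add: z inner_sum_right inner_commute)
  qed
  then have "flat g z = \<xi>" by (rule blinfun_eqI)
  then show thesis by (rule that)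
qed

subsection \<open>The splitting defined by a metric\<close>

locale metric_double =
  fixes g :: "'a::euclidean_space \<Rightarrow> 'a \<Rightarrow> real"
  assumes pseudo_metric: "pseudo_metric g"
begin

lemma linear_g: "linear (g x)" "linear (\<lambda>x. g x y)"
  using pseudo_metric unfolding pseudo_metric_def bilinear_def by blast+

lemma g_commute: "g x y = g y x"
  using pseudo_metric unfolding pseudo_metric_def by blast

lemma flat_apply: "blinfun_apply (flat g x) y = g x y"
  by (simp add: flat_def blinfun_apply_Blinfun_linear linear_g)

lemma linear_flat: "linear (flat g)"
  by (rule linearI; rule blinfun_eqI)
    (simp_all add: flat_apply blinfun.bilinear_simps linear_add[OF linear_g(2)] linear_scale[OF linear_g(2)])

lemma flat_uminus: "flat (\<lambda>x y. - g x y) x = - flat g x"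
  by (rule blinfun_eqI)
    (simp add: flat_apply blinfun.bilinear_simps flat_def blinfun_apply_Blinfun_linear linear_compose_neg linear_g)

lemma flat_eq_0: "flat g x = 0 \<longleftrightarrow> x = 0"
  using pseudo_metric linear_0[OF linear_flat] unfolding pseudo_metric_def
  by (metis flat_apply zero_blinfun.rep_eq)

lemma E_plus_uminus: "E_plus (\<lambda>x y. - g x y) = E_minus g"
  by (simp add: E_plus_def E_minus_def flat_uminus)

lemma E_minus_uminus: "E_minus (\<lambda>x y. - g x y) = E_plus g"
  by (simp add: E_plus_def E_minus_def flat_uminus)

lemma pr_plus_uminus: "pr_plus (\<lambda>x y. - g x y) = pr_minus g"
  by (rule ext) (simp add: pr_plus_def pr_minus_def E_plus_uminus E_minus_uminus)

lemma pr_minus_uminus: "pr_minus (\<lambda>x y. - g x y) = pr_plus g"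
  by (rule ext) (simp add: pr_plus_def pr_minus_def E_plus_uminus E_minus_uminus)

lemma metric_double_uminus: "metric_double (\<lambda>x y. - g x y)"
proof
  have "bilinear (\<lambda>x y. - g x y)"
    unfolding bilinear_def by (simp add: linear_compose_neg linear_g)
  then show "pseudo_metric (\<lambda>x y. - g x y)"
    using pseudo_metric by (simp add: pseudo_metric_def)
qed

lemma subspace_E_plus: "subspace (E_plus g)"
proof -
  have "linear (\<lambda>x. (x, flat g x))"
    by (rule linearI) (simp_all add: linear_add[OF linear_flat] linear_scale[OF linear_flat])
  then show ?thesis
    unfolding E_plus_def by (simp add: linear_subspace_image)
qed

lemma subspace_E_minus: "subspace (E_minus g)"
  using metric_double.subspace_E_plus[OF metric_double_uminus] by (simp add: E_plus_uminus)

lemma pairing_E_plus_E_minus: "x \<in> E_plus g \<Longrightarrow> y \<in> E_minus g \<Longrightarrow> pairing x y = 0"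
  by (auto simp: E_plus_def E_minus_def pairing_def flat_apply blinfun.bilinear_simps g_commute)

lemma E_decomposition:
  obtains w where "w \<in> E_plus g" "u - w \<in> E_minus g"
proof -
  obtain z where z: "flat g z = snd u"
    using flat_surj[of g] pseudo_metric unfolding pseudo_metric_def by metis
  \<comment> \<open>With \<open>u = (x, flat g z)\<close>, the two components require
    \<open>?p + ?m = x\<close> and \<open>?p - ?m = z\<close>.\<close>
  let ?p = "(1/2) *\<^sub>R (fst u + z)" and ?m = "(1/2) *\<^sub>R (fst u - z)"
  have "u - (?p, flat g ?p) = (?m, - flat g ?m)"
    by (simp add: prod_eq_iff linear_scale[OF linear_flat] linear_add[OF linear_flat]
        linear_diff[OF linear_flat] z algebra_simps flip: scaleR_add_left)
  then show thesis using that[of "(?p, flat g ?p)"] by (auto simp: E_plus_def E_minus_def)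
qed

lemma E_plus_Int_E_minus: "x \<in> E_plus g \<Longrightarrow> x \<in> E_minus g \<Longrightarrow> x = 0"
  by (auto simp: E_plus_def E_minus_def zero_prod_def linear_0[OF linear_flat] eq_neg_iff_add_eq_0
      simp flip: linear_add[OF linear_flat] scaleR_2)
    (auto simp: flat_eq_0)

text \<open>Two candidates for the \<open>THE\<close> differ by an element of both
  \<open>E_plus\<close> and \<open>E_minus\<close>, hence by 0. Values of the projection are then
  found by exhibiting a decomposition.\<close>

lemma pr_plus_eqI:
  assumes "w \<in> E_plus g" "u - w \<in> E_minus g"
  shows "pr_plus g u = w"
  unfolding pr_plus_def
proof (rule the_equality)
  fix w' assume w': "w' \<in> E_plus g \<and> u - w' \<in> E_minus g"
  have "w' - w \<in> E_plus g" using assms w' subspace_diff[OF subspace_E_plus] by blast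
  moreover have "(u - w) - (u - w') \<in> E_minus g" using assms w' subspace_diff[OF subspace_E_minus] by blast
  ultimately have "w' - w = 0" by (intro E_plus_Int_E_minus) auto
  then show "w' = w" by simp
qed (use assms in simp)

lemma pr_plus_mem: "pr_plus g u \<in> E_plus g"
  and diff_pr_plus_mem: "u - pr_plus g u \<in> E_minus g"
  using E_decomposition[of u] pr_plus_eqI by metis+

lemma pr_minus_mem: "pr_minus g u \<in> E_minus g"
  using metric_double.pr_plus_mem[OF metric_double_uminus] by (simp add: E_plus_uminus pr_plus_uminus)

lemma pr_minus_eq: "pr_minus g u = u - pr_plus g u"
  using metric_double.pr_plus_eqI[OF metric_double_uminus, of "u - pr_plus g u" u] pr_plus_mem diff_pr_plus_mem
  by (simp add: E_plus_uminus pr_plus_uminus E_minus_uminus)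

lemma pr_plus_add_pr_minus: "pr_plus g u + pr_minus g u = u"
  by (simp add: pr_minus_eq)

lemma linear_pr_plus: "linear (pr_plus g)"
proof (rule linearI)
  fix x y :: "'a double" and r
  show "pr_plus g (x + y) = pr_plus g x + pr_plus g y"
    using subspace_add[OF subspace_E_minus diff_pr_plus_mem diff_pr_plus_mem, of x y]
    by (intro pr_plus_eqI subspace_add subspace_E_plus pr_plus_mem) (simp add: algebra_simps)
  show "pr_plus g (r *\<^sub>R x) = r *\<^sub>R pr_plus g x"
    using subspace_scale[OF subspace_E_minus diff_pr_plus_mem, of r x]
    by (intro pr_plus_eqI subspace_scale subspace_E_plus pr_plus_mem) (simp add: algebra_simps)
qed

lemma linear_pr_minus: "linear (pr_minus g)"
  using metric_double.linear_pr_plus[OF metric_double_uminus] by (simp add: pr_plus_uminus)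

lemma pr_plus_E_plus: "x \<in> E_plus g \<Longrightarrow> pr_plus g x = x"
  by (rule pr_plus_eqI) (simp_all add: subspace_0[OF subspace_E_minus])

lemma pr_plus_E_minus: "x \<in> E_minus g \<Longrightarrow> pr_plus g x = 0"
  by (rule pr_plus_eqI) (simp_all add: subspace_0[OF subspace_E_plus])

lemma pr_minus_E_minus: "x \<in> E_minus g \<Longrightarrow> pr_minus g x = x"
  by (simp add: pr_minus_eq pr_plus_E_minus)

lemma pr_minus_E_plus: "x \<in> E_plus g \<Longrightarrow> pr_minus g x = 0"
  by (simp add: pr_minus_eq pr_plus_E_plus)

lemma pairing_pr_plus: "pairing (pr_plus g x) y = pairing (pr_plus g x) (pr_plus g y)"
  using pairing_E_plus_E_minus[OF pr_plus_mem pr_minus_mem, of x y]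
  by (simp add: pr_minus_eq pairing_simps)

text \<open>As \<open>E_plus\<close> and \<open>E_minus\<close> are orthogonal, both sides equal the
  pairing of the two projections.\<close>

lemma pairing_pr_plus_swap: "pairing (pr_plus g x) y = pairing x (pr_plus g y)"
  by (metis pairing_pr_plus pairing_commute)

text \<open>The pairing stays nondegenerate on \<open>E_plus\<close>: self-adjointness of
  \<open>pr_plus\<close> replaces an arbitrary test vector by its projection.\<close>

lemma E_plus_eqI:
  assumes "x \<in> E_plus g" "y \<in> E_plus g" "\<And>w. w \<in> E_plus g \<Longrightarrow> pairing x w = pairing y w"
  shows "x = y"
proof -
  have "pairing (x - y) w = 0" for w
  proof -
    have "pairing (x - y) w = pairing (x - y) (pr_plus g w)"
      using pairing_pr_plus_swap[of "x - y" w] assms(1,2)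
      by (simp add: pr_plus_E_plus subspace_diff[OF subspace_E_plus])
    then show ?thesis using assms(3)[OF pr_plus_mem, of w] by (simp add: pairing_simps)
  qed
  then show ?thesis using pairing_nondegenerate by fastforce
qed

end

subsection \<open>The Dorfman bracket\<close>

locale dorfman_data =
  fixes br :: "'a::euclidean_space \<Rightarrow> 'a \<Rightarrow> 'a"
    and H :: "'a \<Rightarrow> 'a \<Rightarrow> 'a \<Rightarrow> real"
  assumes lie_bracket: "lie_bracket br" and three_form: "three_form H"
begin

lemma bilinear_br: "bilinear br"
  using lie_bracket by (simp add: lie_bracket_def)

lemma linear_H: "linear (\<lambda>z. H x y z)" "linear (\<lambda>y. H x y z)" "linear (\<lambda>x. H x y z)"
  using three_form by (auto simp: three_form_def)

lemma br_swap: "br x y = - br y x"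
proof -
  have "br (x + y) (x + y) = 0" "br x x = 0" "br y y = 0"
    using lie_bracket by (auto simp: lie_bracket_def)
  then show ?thesis
    by (simp add: bilinear_ladd[OF bilinear_br] bilinear_radd[OF bilinear_br] eq_neg_iff_add_eq_0 add.commute)
qed

lemma H_swap: "H x y z = - H y x z" "H x y z = - H x z y"
proof -
  have "H (x + y) (x + y) z = 0" "H x x z = 0" "H y y z = 0"
    using three_form by (auto simp: three_form_def)
  then show "H x y z = - H y x z"
    by (simp add: linear_add[OF linear_H(2)] linear_add[OF linear_H(3)])
  have "H x (y + z) (y + z) = 0" "H x y y = 0" "H x z z = 0"
    using three_form by (auto simp: three_form_def)
  then show "H x y z = - H x z y"
    by (simp add: linear_add[OF linear_H(1)] linear_add[OF linear_H(2)])
qed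

lemma coad_apply: "blinfun_apply (coad br x \<eta>) z = blinfun_apply \<eta> (br x z)"
proof -
  have "linear (\<lambda>z. blinfun_apply \<eta> (br x z))"
    by (rule linearI) (simp_all add: bilinear_radd[OF bilinear_br] bilinear_rmul[OF bilinear_br] blinfun.bilinear_simps)
  then show ?thesis by (simp add: coad_def blinfun_apply_Blinfun_linear)
qed

text \<open>Identities for the bracket are checked on its pairings, where they become scalar
  identities for \<open>br\<close>, \<open>H\<close> and covectors. The factor 2 clears the 1/2 in
  \<open>pairing\<close>.\<close>

lemma pairing_dorfman:
  "2 * pairing (dorfman br H u v) w =
     - blinfun_apply (snd v) (br (fst u) (fst w)) + blinfun_apply (snd u) (br (fst v) (fst w))
     + H (fst u) (fst v) (fst w) + blinfun_apply (snd w) (br (fst u) (fst v))"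
  by (simp add: pairing_def dorfman_def coad_apply blinfun.bilinear_simps blinfun_apply_Blinfun_linear linear_H)

lemma dorfman_eqI: "(\<And>w. 2 * pairing x w = 2 * pairing y w) \<Longrightarrow> x = y"
  using pairing_nondegenerate[of "x - y"] by (simp add: pairing_simps)

lemma bilinear_dorfman: "bilinear (dorfman br H)"
  unfolding bilinear_def
proof safe
  fix x :: "'a double"
  show "linear (dorfman br H x)"
    by (rule linearI; rule dorfman_eqI)
      (simp_all only: pairing_dorfman pairing_simps distrib_left mult.left_commute[of 2],
        simp_all add: pairing_dorfman bilinear_ladd[OF bilinear_br] bilinear_lmul[OF bilinear_br] bilinear_radd[OF bilinear_br] bilinear_rmul[OF bilinear_br]
        linear_add[OF linear_H(2)] linear_scale[OF linear_H(2)] blinfun.bilinear_simps algebra_simps)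
  show "linear (\<lambda>y. dorfman br H y x)"
    by (rule linearI; rule dorfman_eqI)
      (simp_all only: pairing_dorfman pairing_simps distrib_left mult.left_commute[of 2],
        simp_all add: pairing_dorfman bilinear_ladd[OF bilinear_br] bilinear_lmul[OF bilinear_br] bilinear_radd[OF bilinear_br] bilinear_rmul[OF bilinear_br]
        linear_add[OF linear_H(3)] linear_scale[OF linear_H(3)] blinfun.bilinear_simps algebra_simps)
qed

text \<open>In general the symmetric part of a Dorfman bracket is a differential of the scalar
  product, which is constant on left-invariant sections.\<close>

lemma dorfman_swap: "dorfman br H u v = - dorfman br H v u"
proof (rule dorfman_eqI)
  fix w
  show "2 * pairing (dorfman br H u v) w = 2 * pairing (- dorfman br H v u) w"
    using pairing_dorfman[of u v w] pairing_dorfman[of v u w]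
      H_swap(1)[of "fst u" "fst v" "fst w"] br_swap[of "fst u" "fst v"]
    by (simp add: pairing_simps blinfun.bilinear_simps)
qed

text \<open>Invariance of the scalar product, again without a derivative term. With
  \<open>dorfman_swap\<close> it makes \<open>pairing (dorfman br H u v) w\<close> totally
  skew.\<close>

lemma pairing_dorfman_invariant: "pairing (dorfman br H u v) w = - pairing v (dorfman br H u w)"
  using pairing_dorfman[of u v w] pairing_dorfman[of u w v]
    H_swap(2)[of "fst u" "fst v" "fst w"] br_swap[of "fst v" "fst w"]
  by (simp add: pairing_commute[of v] blinfun.bilinear_simps)

end

subsection \<open>Levi-Civita connections and their curvature\<close>

locale generalized_metric = metric_double g + dorfman_data br H
  for br :: "'a::euclidean_space \<Rightarrow> 'a \<Rightarrow> 'a"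
    and H :: "'a \<Rightarrow> 'a \<Rightarrow> 'a \<Rightarrow> real"
    and g :: "'a \<Rightarrow> 'a \<Rightarrow> real"
begin

lemma generalized_metric_uminus: "generalized_metric br H (\<lambda>x y. - g x y)"
  by (intro generalized_metric.intro metric_double_uminus dorfman_data_axioms)

lemma levi_civita_uminus: "levi_civita br H (\<lambda>x y. - g x y) = levi_civita br H g"
  unfolding levi_civita_def E_plus_uminus E_minus_uminus by blast

text \<open>The Levi-Civita condition is the same predicate for \<open>g\<close> and its negative,
  so the \<open>SOME\<close> in \<open>chosen_connection\<close> picks one and the same connection
  for both.\<close>

lemma Ric_plus_uminus: "Ric_plus br H (\<lambda>x y. - g x y) = Ric_minus br H g"
  by (intro ext) (simp add: Ric_plus_def Ric_minus_def chosen_connection_def levi_civita_uminus E_plus_uminus)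

text \<open>Paired with \<open>w\<close>, the term \<open>- D v u\<close> becomes
  \<open>pairing (D v w) u\<close> by skewness of \<open>D v\<close>, and the adjoint term becomes
  \<open>pairing (D w u) v\<close>.\<close>

lemma torsion_eq_0_iff:
  assumes D: "gen_connection D"
  shows "torsion br H D u v = 0 \<longleftrightarrow>
    (\<forall>w. pairing (D u v) w + pairing (D v w) u + pairing (D w u) v = pairing (dorfman br H u v) w)"
proof -
  have skew: "pairing (D v u) w = - pairing (D v w) u" for w
    using D pairing_commute[of u "D v w"] unfolding gen_connection_def by (metis add_eq_0_iff2)
  have "linear (\<lambda>w. D w u)"
    using D unfolding gen_connection_def bilinear_def by blast
  then have "pairing (pairing_adjoint (\<lambda>w. D w u) v) w = pairing (D w u) v" for w
    by (metis pairing_adjoint_works pairing_commute)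
  then have *: "pairing (torsion br H D u v) w =
      pairing (D u v) w + pairing (D v w) u + pairing (D w u) v - pairing (dorfman br H u v) w" for w
    by (simp add: torsion_def pairing_simps skew)
  show ?thesis
    using * pairing_nondegenerate[of "torsion br H D u v"] by (auto simp: pairing_simps)
qed

context
  fixes D :: "'a double \<Rightarrow> 'a double \<Rightarrow> 'a double"
  assumes D: "levi_civita br H g D"
begin

lemma levi_civita_bilinear: "bilinear D"
  using D by (simp add: levi_civita_def gen_connection_def)

lemma levi_civita_linear: "linear (D u)" "linear (\<lambda>u. D u v)"
  using levi_civita_bilinear unfolding bilinear_def by blast+

lemma levi_civita_E_plus: "x \<in> E_plus g \<Longrightarrow> D u x \<in> E_plus g"
  using D unfolding levi_civita_def by blast

lemma levi_civita_E_minus: "x \<in> E_minus g \<Longrightarrow> D u x \<in> E_minus g"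
  using D unfolding levi_civita_def by blast

lemma levi_civita_mixed:
  assumes "x \<in> E_minus g" "y \<in> E_plus g"
  shows "D x y = pr_plus g (dorfman br H x y)"
proof (rule E_plus_eqI)
  fix w assume w: "w \<in> E_plus g"
  have "pairing (D x y) w + pairing (D y w) x + pairing (D w x) y = pairing (dorfman br H x y) w"
    using D torsion_eq_0_iff unfolding levi_civita_def by blast
  \<comment> \<open>\<open>D y w\<close> stays in \<open>E_plus\<close> and \<open>D w x\<close> in
    \<open>E_minus\<close>, so these two cyclic terms pair orthogonal vectors; the third one is then
    determined by the bracket.\<close>
  moreover have "pairing (D y w) x = 0" "pairing (D w x) y = 0"
    using pairing_E_plus_E_minus assms w levi_civita_E_plus levi_civita_E_minus pairing_commute by metis+
  ultimately show "pairing (D x y) w = pairing (pr_plus g (dorfman br H x y)) w"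
    using w by (simp add: pairing_pr_plus_swap pr_plus_E_plus)
qed (use assms levi_civita_E_plus pr_plus_mem in auto)

end

lemma linear_dorfman: "linear (dorfman br H u)" "linear (\<lambda>u. dorfman br H u v)"
  using bilinear_dorfman unfolding bilinear_def by blast+

lemma linear_Gamma: "linear (Gamma_plus br H g u)" "linear (Gamma_minus br H g u)"
  using linear_compose[OF linear_dorfman(1) linear_pr_plus]
    linear_compose[OF linear_dorfman(1) linear_pr_minus]
  by (simp_all add: Gamma_plus_def Gamma_minus_def comp_def)

theorem trace_curvature:
  assumes D: "levi_civita br H g D" and um: "um \<in> E_minus g" and up: "up \<in> E_plus g"
  shows "trace_on (E_plus g) (\<lambda>w. curvature br H D w um up) =
    - trace_on (E_minus g) (Gamma_minus br H g um \<circ> Gamma_plus br H g up)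
    + divergence D (pr_plus g (dorfman br H um up))"
proof -
  obtain S :: "'a double set" where S: "finite S" "\<And>V. V \<subseteq> span S"
    by (rule double_finite_span) blast
  note lin = levi_civita_linear[OF D] and Ep = levi_civita_E_plus[OF D]
  let ?x = "pr_plus g (dorfman br H um up)"
  have *: "curvature br H D w um up = D w ?x - (D um (D w up) - D (D um w) up)
       - (Gamma_plus br H g up \<circ> Gamma_minus br H g um) w" if w: "w \<in> E_plus g" for w
  proof -
    \<comment> \<open>Both parts of the split bracket yield to the mixed formula: the
      \<open>E_plus\<close> part is \<open>- D um w\<close>, and the \<open>E_minus\<close> part,
      acting on \<open>up\<close>, produces the composition of the two Gammas.\<close>
    have "dorfman br H w um = pr_plus g (dorfman br H w um) + pr_minus g (dorfman br H w um)"
      by (simp add: pr_plus_add_pr_minus)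
    also have "\<dots> = - D um w - pr_minus g (dorfman br H um w)"
      using levi_civita_mixed[OF D um w] dorfman_swap[of w um]
      by (simp add: linear_neg[OF linear_pr_plus] linear_neg[OF linear_pr_minus])
    finally have "D (dorfman br H w um) up = - D (D um w) up - D (pr_minus g (dorfman br H um w)) up"
      by (simp add: linear_neg[OF lin(2)] linear_diff[OF lin(2)])
    also have "D (pr_minus g (dorfman br H um w)) up = - Gamma_plus br H g up (Gamma_minus br H g um w)"
      using levi_civita_mixed[OF D pr_minus_mem up] dorfman_swap[of _ up]
      by (simp add: Gamma_plus_def Gamma_minus_def linear_neg[OF linear_pr_plus])
    finally show ?thesis
      using levi_civita_mixed[OF D um up] by (simp add: curvature_def)
  qed
  have "trace_on (E_plus g) (\<lambda>w. curvature br H D w um up) =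
      trace_on (E_plus g) (\<lambda>w. D w ?x - (D um (D w up) - D (D um w) up)
        - (Gamma_plus br H g up \<circ> Gamma_minus br H g um) w)"
    by (rule trace_on_cong[OF S *])
  also have "\<dots> = trace_on (E_plus g) (\<lambda>w. D w ?x) - trace_on (E_plus g) (\<lambda>w. D um (D w up) - D (D um w) up)
      - trace_on (E_plus g) (Gamma_plus br H g up \<circ> Gamma_minus br H g um)"
    by (subst trace_on_diff[OF S], use up in \<open>auto simp: Gamma_plus_def pr_plus_mem intro!: Ep subspace_diff[OF subspace_E_plus]\<close>)
      (subst trace_on_diff[OF S], use up in \<open>auto simp: pr_plus_mem intro!: Ep subspace_diff[OF subspace_E_plus]\<close>)
  also have "trace_on (E_plus g) (\<lambda>w. D um (D w up) - D (D um w) up) =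
      trace_on (E_plus g) (D um \<circ> (\<lambda>w. D w up)) - trace_on (E_plus g) ((\<lambda>w. D w up) \<circ> D um)"
    unfolding comp_def using up by (intro trace_on_diff[OF S]) (auto intro!: Ep)
  \<comment> \<open>Both factors preserve \<open>E_plus\<close>, so their commutator is traceless
    there.\<close>
  also have "trace_on (E_plus g) (D um \<circ> (\<lambda>w. D w up)) = trace_on (E_plus g) ((\<lambda>w. D w up) \<circ> D um)"
    using up by (intro trace_on_comp_swap[OF S S] lin) (auto intro!: Ep)
  also have "trace_on (E_plus g) (Gamma_plus br H g up \<circ> Gamma_minus br H g um) =
      trace_on (E_minus g) (Gamma_minus br H g um \<circ> Gamma_plus br H g up)"
    by (intro trace_on_comp_swap[OF S S] linear_Gamma)
      (auto simp: Gamma_plus_def Gamma_minus_def pr_plus_mem pr_minus_mem)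
  \<comment> \<open>Since \<open>?x\<close> lies in \<open>E_plus\<close>, so does every
    \<open>D w ?x\<close>, and the trace over the whole double reduces to
    \<open>E_plus\<close>.\<close>
  also have "trace_on (E_plus g) (\<lambda>w. D w ?x) = divergence D ?x"
    unfolding divergence_def
    by (rule trace_on_subspace[OF S S lin(2), symmetric]) (auto intro!: Ep pr_plus_mem)
  finally show ?thesis by (simp add: comp_def)
qed

end

subsection \<open>Orthonormal frames\<close>

locale orthonormal_frame = metric_double g
  for g :: "'a::euclidean_space \<Rightarrow> 'a \<Rightarrow> real" +
  fixes n :: nat and v :: "nat \<Rightarrow> 'a"
  assumes orthonormal: "orthonormal_basis g n v"
begin

abbreviation "e \<equiv> frame g n v"

text \<open>The sign of a basis vector is its own inverse; expansions carry it as a factor and so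
  cover every signature.\<close>

lemma g_basis: "a \<in> {1..n} \<Longrightarrow> b \<in> {1..n} \<Longrightarrow> a \<noteq> b \<Longrightarrow> g (v a) (v b) = 0"
  and g_basis_sq: "a \<in> {1..n} \<Longrightarrow> g (v a) (v a) * g (v a) (v a) = 1"
  using orthonormal abs_mult_self_eq[of "g (v a) (v a)"]
  by (auto simp: orthonormal_basis_def)

lemma orthonormal_frame_uminus: "orthonormal_frame (\<lambda>x y. - g x y) n v"
  using metric_double_uminus orthonormal
  by (auto simp: orthonormal_frame_def orthonormal_frame_axioms_def orthonormal_basis_def)

lemma frame_uminus: "a \<in> {1..n} \<Longrightarrow> frame (\<lambda>x y. - g x y) n v a = e (a + n)"
  by (simp add: frame_def flat_uminus)

lemma orthonormal_expansion: "y = (\<Sum>a\<in>{1..n}. (g (v a) (v a) * g (v a) y) *\<^sub>R v a)"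
proof -
  let ?f = "\<lambda>y. \<Sum>a\<in>{1..n}. (g (v a) (v a) * g (v a) y) *\<^sub>R v a"
  have "linear ?f"
    by (rule linearI) (simp_all add: linear_add[OF linear_g(1)] linear_scale[OF linear_g(1)]
        algebra_simps sum.distrib scaleR_sum_right)
  moreover have "id y = ?f y" if "y \<in> v ` {1..n}" for y
  proof -
    from that obtain b where b: "b \<in> {1..n}" "y = v b" by auto
    have "?f y = (\<Sum>a\<in>{1..n}. if a = b then v b else 0)"
      using b g_basis g_basis_sq by (intro sum.cong) auto
    then show ?thesis using b by simp
  qed
  moreover have "y \<in> span (v ` {1..n})" using orthonormal by (simp add: orthonormal_basis_def)
  ultimately show ?thesis
    using linear_eq_on[OF linear_id, of ?f y "v ` {1..n}"] by simp
qed

lemma frame_E_plus: "a \<in> {1..n} \<Longrightarrow> e a \<in> E_plus g"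
  by (simp add: frame_def E_plus_def)

lemma frame_E_minus: "i \<in> {n+1..2*n} \<Longrightarrow> e i \<in> E_minus g"
  by (auto simp: frame_def E_minus_def)

lemma pairing_frame_E_plus:
  "a \<in> {1..n} \<Longrightarrow> pairing (e a) (x, flat g x) = g (v a) x"
  by (simp add: frame_def pairing_def flat_apply g_commute[of x])

lemma E_plus_expansion:
  assumes "x \<in> E_plus g"
  shows "x = (\<Sum>a\<in>{1..n}. (pairing (e a) (e a) * pairing (e a) x) *\<^sub>R e a)"
proof -
  have flat: "flat g y = (\<Sum>a\<in>{1..n}. (g (v a) (v a) * g (v a) y) *\<^sub>R flat g (v a))" for y
    using arg_cong[OF orthonormal_expansion[of y], of "flat g"]
    by (simp only: linear_sum[OF linear_flat] linear_scale[OF linear_flat])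
  obtain y where y: "x = (y, flat g y)" using assms by (auto simp: E_plus_def)
  have "(\<Sum>a\<in>{1..n}. (pairing (e a) (e a) * pairing (e a) x) *\<^sub>R e a) =
     (\<Sum>a\<in>{1..n}. (g (v a) (v a) * g (v a) y) *\<^sub>R (v a, flat g (v a)))"
    using y by (intro sum.cong refl) (auto simp: pairing_frame_E_plus frame_def pairing_def flat_apply g_commute[of y])
  also have "\<dots> = (y, flat g y)"
    by (simp only: prod_eq_iff fst_sum snd_sum fst_scaleR snd_scaleR fst_conv snd_conv
        orthonormal_expansion[symmetric] flat[symmetric])
  finally show ?thesis using y by simp
qed

lemma pairing_frame_sq: "A \<in> {1..2*n} \<Longrightarrow> pairing (e A) (e A) * pairing (e A) (e A) = 1"
proof (cases "A \<le> n")
  case False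
  assume "A \<in> {1..2*n}"
  with False have "A - n \<in> {1..n}" by auto
  then show ?thesis using g_basis_sq False
    by (simp add: frame_def pairing_def flat_apply blinfun.bilinear_simps)
qed (use g_basis_sq in \<open>simp add: frame_def pairing_def flat_apply\<close>)

lemma pairing_frame_neq:
  "A \<in> {1..2*n} \<Longrightarrow> B \<in> {1..2*n} \<Longrightarrow> A \<noteq> B \<Longrightarrow> pairing (e A) (e B) = 0"
proof -
  assume AB: "A \<in> {1..2*n}" "B \<in> {1..2*n}" "A \<noteq> B"
  consider "A \<le> n" "B \<le> n" | "A \<le> n" "B > n" | "A > n" "B \<le> n" | "A > n" "B > n" by linarith
  then show ?thesis
  proof cases
    case 1
    then show ?thesis using AB g_basis[of A B] g_basis[of B A]
      by (simp add: frame_def pairing_def flat_apply)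
  next
    case 2
    then show ?thesis using AB by (intro pairing_E_plus_E_minus frame_E_plus frame_E_minus) auto
  next
    case 3
    then show ?thesis using AB unfolding pairing_commute[of "e A"]
      by (intro pairing_E_plus_E_minus frame_E_plus frame_E_minus) auto
  next
    case 4
    then have "A - n \<in> {1..n}" "B - n \<in> {1..n}" "A - n \<noteq> B - n" using AB by auto
    then show ?thesis using 4 g_basis
      by (auto simp add: frame_def pairing_def flat_apply blinfun.bilinear_simps)
  qed
qed

text \<open>The functional dual to \<open>e A\<close>: dividing by
  \<open>pairing (e A) (e A)\<close> is multiplying by it, as it is 1 or -1.\<close>

definition coord :: "nat \<Rightarrow> 'a double \<Rightarrow> real" where
  "coord A x = pairing (e A) (e A) * pairing (e A) x"

lemma linear_coord: "linear (coord A)"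
  by (rule linearI) (simp_all add: coord_def pairing_simps algebra_simps)

text \<open>A general \<open>K\<close> lets coefficients be read off a full expansion as well as off
  its projection to \<open>E_minus\<close>.\<close>

lemma coord_sum:
  assumes "A \<in> {1..2*n}" "K \<subseteq> {1..2*n}"
  shows "coord A (\<Sum>C\<in>K. c C *\<^sub>R e C) = (if A \<in> K then c A else 0)"
proof -
  have "finite K" using assms finite_subset by blast
  have "coord A (\<Sum>C\<in>K. c C *\<^sub>R e C) = (\<Sum>C\<in>K. if C = A then c A else 0)"
    unfolding linear_sum[OF linear_coord] linear_scale[OF linear_coord]
    using assms pairing_frame_sq pairing_frame_neq
    by (intro sum.cong) (auto simp: coord_def subset_iff)
  then show ?thesis using \<open>finite K\<close> by simp
qed

lemma E_plus_coord: "x \<in> E_plus g \<Longrightarrow> x = (\<Sum>a\<in>{1..n}. coord a x *\<^sub>R e a)"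
  unfolding coord_def by (rule E_plus_expansion)

lemma E_minus_coord: "x \<in> E_minus g \<Longrightarrow> x = (\<Sum>i\<in>{n+1..2*n}. coord i x *\<^sub>R e i)"
proof -
  assume x: "x \<in> E_minus g"
  \<comment> \<open>\<open>x\<close> is expanded in the \<open>E_plus\<close> of the negated metric,
    whose frame vector number \<open>a\<close> is \<open>e (a + n)\<close>.\<close>
  let ?e = "frame (\<lambda>x y. - g x y) n v"
  have "x = (\<Sum>a\<in>{1..n}. (pairing (?e a) (?e a) * pairing (?e a) x) *\<^sub>R ?e a)"
    using orthonormal_frame.E_plus_expansion[OF orthonormal_frame_uminus, of x] x
    by (simp add: E_plus_uminus)
  also have "\<dots> = (\<Sum>a\<in>{1..n}. coord (a + n) x *\<^sub>R e (a + n))"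
    by (intro sum.cong refl) (simp add: coord_def frame_uminus)
  also have "\<dots> = (\<Sum>i\<in>{1+n..n+n}. coord i x *\<^sub>R e i)"
    by (rule sum.shift_bounds_cl_nat_ivl[symmetric])
  finally show ?thesis by (simp add: mult_2 add.commute)
qed

lemma trace_on_E_plus:
  assumes "linear f" "f ` E_plus g \<subseteq> E_plus g"
  shows "trace_on (E_plus g) f = (\<Sum>a\<in>{1..n}. coord a (f (e a)))"
proof -
  obtain S :: "'a double set" where S: "finite S" "\<And>V. V \<subseteq> span S"
    by (rule double_finite_span) blast
  show ?thesis
    by (rule trace_on_eq_sum[OF S assms frame_E_plus linear_coord E_plus_coord])
qed

lemma trace_on_E_minus:
  assumes "linear f" "f ` E_minus g \<subseteq> E_minus g"
  shows "trace_on (E_minus g) f = (\<Sum>i\<in>{n+1..2*n}. coord i (f (e i)))"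
proof -
  obtain S :: "'a double set" where S: "finite S" "\<And>V. V \<subseteq> span S"
    by (rule double_finite_span) blast
  show ?thesis
    by (rule trace_on_eq_sum[OF S assms frame_E_minus linear_coord E_minus_coord])
qed

lemma pr_plus_sum_frame: "pr_plus g (\<Sum>A\<in>{1..2*n}. c A *\<^sub>R e A) = (\<Sum>a\<in>{1..n}. c a *\<^sub>R e a)"
  and pr_minus_sum_frame: "pr_minus g (\<Sum>A\<in>{1..2*n}. c A *\<^sub>R e A) = (\<Sum>i\<in>{n+1..2*n}. c i *\<^sub>R e i)"
proof -
  have *: "(\<Sum>A\<in>{1..2*n}. c A *\<^sub>R e A) = (\<Sum>a\<in>{1..n}. c a *\<^sub>R e a) + (\<Sum>i\<in>{n+1..2*n}. c i *\<^sub>R e i)"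
    using sum.ub_add_nat[of 1 n "\<lambda>A. c A *\<^sub>R e A" n] by (simp add: mult_2)
  show plus: "pr_plus g (\<Sum>A\<in>{1..2*n}. c A *\<^sub>R e A) = (\<Sum>a\<in>{1..n}. c a *\<^sub>R e a)"
    using frame_E_plus frame_E_minus unfolding *
    by (intro pr_plus_eqI)
      (auto intro!: subspace_sum subspace_E_plus subspace_E_minus subspace_scale)
  show "pr_minus g (\<Sum>A\<in>{1..2*n}. c A *\<^sub>R e A) = (\<Sum>i\<in>{n+1..2*n}. c i *\<^sub>R e i)"
    unfolding pr_minus_eq plus unfolding * by simp
qed

end

subsection \<open>Existence of a Levi-Civita connection with given divergence\<close>

text \<open>The part of the connection acting on \<open>E_plus\<close>; the part on
  \<open>E_minus\<close> is the same expression for the negated metric. The first summand is forced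
  by \<open>levi_civita_mixed\<close>, the factor 1/3 compensates for three equal terms in the
  cyclic sum, and the last summand adjusts the divergence.\<close>

definition half_connection ::
  "('a::euclidean_space \<Rightarrow> 'a \<Rightarrow> 'a) \<Rightarrow> ('a \<Rightarrow> 'a \<Rightarrow> 'a \<Rightarrow> real) \<Rightarrow> ('a \<Rightarrow> 'a \<Rightarrow> real) \<Rightarrow>
   'a double \<Rightarrow> real \<Rightarrow> 'a double \<Rightarrow> 'a double \<Rightarrow> 'a double" where
  "half_connection br H g a c u v =
     pr_plus g (dorfman br H (pr_minus g u) (pr_plus g v))
     + (1/3) *\<^sub>R pr_plus g (dorfman br H (pr_plus g u) (pr_plus g v))
     + c *\<^sub>R (pairing (pr_plus g u) v *\<^sub>R pr_plus g a - pairing a (pr_plus g v) *\<^sub>R pr_plus g u)"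

context generalized_metric begin

lemma half_connection_E_plus: "half_connection br H g a c u v \<in> E_plus g"
  unfolding half_connection_def
  by (intro subspace_add subspace_diff subspace_scale subspace_E_plus pr_plus_mem)

lemma half_connection_eq_0: "v \<in> E_minus g \<Longrightarrow> half_connection br H g a c u v = 0"
  using pairing_E_plus_E_minus[OF pr_plus_mem, of v u]
  by (simp add: half_connection_def pr_plus_E_minus pairing_simps linear_0[OF linear_pr_plus] linear_0[OF linear_dorfman(1)])

lemma bilinear_half_connection: "bilinear (half_connection br H g a c)"
  unfolding bilinear_def half_connection_def
  by (intro conjI allI linearI) (simp_all add: linear_add[OF linear_pr_plus] linear_scale[OF linear_pr_plus]
      linear_add[OF linear_pr_minus] linear_scale[OF linear_pr_minus]
      bilinear_ladd[OF bilinear_dorfman] bilinear_radd[OF bilinear_dorfman]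
      bilinear_lmul[OF bilinear_dorfman] bilinear_rmul[OF bilinear_dorfman]
      pairing_simps algebra_simps)

lemma pairing_half_connection:
  "pairing (half_connection br H g a c u v) w =
     pairing (dorfman br H (pr_minus g u) (pr_plus g v)) (pr_plus g w)
     + (1/3) * pairing (dorfman br H (pr_plus g u) (pr_plus g v)) (pr_plus g w)
     + c * (pairing (pr_plus g u) (pr_plus g v) * pairing a (pr_plus g w)
          - pairing a (pr_plus g v) * pairing (pr_plus g u) (pr_plus g w))"
  by (simp add: half_connection_def pairing_simps pairing_pr_plus_swap[of _ w]
      flip: pairing_pr_plus)

lemma pairing_dorfman_cycle: "pairing (dorfman br H x y) z = pairing (dorfman br H y z) x"
proof -
  have "pairing (dorfman br H y z) x = - pairing z (dorfman br H y x)"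
    by (rule pairing_dorfman_invariant)
  also have "\<dots> = pairing z (dorfman br H x y)"
    by (subst dorfman_swap) (simp add: pairing_simps)
  finally show ?thesis by (simp add: pairing_commute)
qed

lemma half_connection_skew:
  "pairing (half_connection br H g a c u v) w + pairing v (half_connection br H g a c u w) = 0"
  using pairing_dorfman_invariant[of "pr_minus g u" "pr_plus g v" "pr_plus g w"]
    pairing_dorfman_invariant[of "pr_plus g u" "pr_plus g v" "pr_plus g w"]
  unfolding pairing_commute[of v] pairing_half_connection
  by (simp add: pairing_commute[of "pr_plus g v" "dorfman _ _ _ _"] algebra_simps)

text \<open>The rotations of the first summand give the components with exactly one
  \<open>E_minus\<close> argument, the three thirds add up to the pure component by cyclic
  invariance, and the terms with \<open>c\<close> cancel by symmetry of the pairing.\<close>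

lemma half_connection_cyclic_sum:
  "pairing (half_connection br H g a c u v) w + pairing (half_connection br H g a c v w) u
     + pairing (half_connection br H g a c w u) v =
   pairing (dorfman br H (pr_minus g u) (pr_plus g v)) (pr_plus g w)
     + pairing (dorfman br H (pr_plus g u) (pr_minus g v)) (pr_plus g w)
     + pairing (dorfman br H (pr_plus g u) (pr_plus g v)) (pr_minus g w)
     + pairing (dorfman br H (pr_plus g u) (pr_plus g v)) (pr_plus g w)"
  unfolding pairing_half_connection
  using pairing_dorfman_cycle[of "pr_plus g u" "pr_plus g v" "pr_plus g w"]
    pairing_dorfman_cycle[of "pr_plus g v" "pr_plus g w" "pr_plus g u"]
    pairing_dorfman_cycle[of "pr_plus g u" "pr_minus g v" "pr_plus g w"]
    pairing_dorfman_cycle[of "pr_minus g w" "pr_plus g u" "pr_plus g v"]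
    pairing_commute[of "pr_plus g u" "pr_plus g v"] pairing_commute[of "pr_plus g u" "pr_plus g w"]
    pairing_commute[of "pr_plus g v" "pr_plus g w"]
  by (simp add: algebra_simps)

lemma trace_half_connection:
  assumes "orthonormal_basis g n v"
  shows "trace_on UNIV (\<lambda>u. half_connection br H g a c u x) = c * (1 - real n) * pairing a (pr_plus g x)"
proof -
  interpret orthonormal_frame g n v using assms by unfold_locales
  obtain S :: "'a double set" where S: "finite S" "\<And>V. V \<subseteq> span S"
    by (rule double_finite_span) blast
  have lin: "linear (\<lambda>u. half_connection br H g a c u x)"
    using bilinear_half_connection unfolding bilinear_def by blast
  have coord: "coord b (half_connection br H g a c (e b) x) =
      c * (coord b (pr_plus g x) * pairing a (e b) - pairing a (pr_plus g x))" if b: "b \<in> {1..n}" for b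
  proof -
    have pr: "pr_plus g (e b) = e b" "pr_minus g (e b) = 0"
      using frame_E_plus[OF b] by (simp_all add: pr_plus_E_plus pr_minus_E_plus)
    \<comment> \<open>A totally skew form with \<open>e b\<close> in two slots. The mixed summand is
      gone too, as \<open>pr_minus g (e b) = 0\<close>, so only the summand with \<open>c\<close>
      enters the trace.\<close>
    have "pairing (dorfman br H (e b) (pr_plus g x)) (e b) = 0"
      using pairing_dorfman_cycle[of "e b" "pr_plus g x" "e b"] dorfman_swap[of "e b" "pr_plus g x"]
      by (simp add: pairing_simps)
    then have eq: "pairing (e b) (half_connection br H g a c (e b) x) =
        c * (pairing (e b) (pr_plus g x) * pairing a (e b) - pairing a (pr_plus g x) * pairing (e b) (e b))"
      using pairing_half_connection[of a c "e b" x "e b"]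
      by (simp add: pr linear_0[OF linear_dorfman(2)] pairing_simps pairing_commute[of "e b" "half_connection _ _ _ _ _ _ _"])
    have "pairing (e b) (e b) * (c * (s * t - r * pairing (e b) (e b))) =
        c * (pairing (e b) (e b) * s * t - r * (pairing (e b) (e b) * pairing (e b) (e b)))" for r s t
      by (simp add: algebra_simps)
    then show ?thesis using pairing_frame_sq[of b] b by (simp add: coord_def eq)
  qed
  have "trace_on UNIV (\<lambda>u. half_connection br H g a c u x) = trace_on (E_plus g) (\<lambda>u. half_connection br H g a c u x)"
    by (rule trace_on_subspace[OF S S lin]) (auto simp: half_connection_E_plus)
  also have "\<dots> = (\<Sum>b\<in>{1..n}. c * (coord b (pr_plus g x) * pairing a (e b) - pairing a (pr_plus g x)))"
    using coord by (subst trace_on_E_plus[OF lin]) (auto simp: half_connection_E_plus)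
  also have "\<dots> = c * (pairing a (\<Sum>b\<in>{1..n}. coord b (pr_plus g x) *\<^sub>R e b) - real n * pairing a (pr_plus g x))"
    unfolding linear_sum[OF linear_pairing]
    by (simp add: pairing_simps sum_subtractf flip: sum_distrib_left)
  also have "(\<Sum>b\<in>{1..n}. coord b (pr_plus g x) *\<^sub>R e b) = pr_plus g x"
    using E_plus_coord[OF pr_plus_mem] by metis
  finally show ?thesis by (simp add: algebra_simps)
qed

theorem levi_civita_with_divergence_exists:
  assumes "orthonormal_basis g n v" "n \<ge> 2" "linear \<delta>"
  shows "\<exists>D. levi_civita br H g D \<and> divergence D = \<delta>"
proof -
  interpret neg: generalized_metric br H "\<lambda>x y. - g x y" by (rule generalized_metric_uminus)
  obtain a where a: "\<And>w. \<delta> w = pairing a w" using pairing_representation[OF assms(3)] by blast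
  obtain S :: "'a double set" where S: "finite S" "\<And>V. V \<subseteq> span S"
    by (rule double_finite_span) blast
  \<comment> \<open>Normalizes the factor \<open>c * (1 - real n)\<close> in
    \<open>trace_half_connection\<close> to 1; \<open>n \<ge> 2\<close> keeps the denominator
    nonzero.\<close>
  define c where "c = 1 / (1 - real n)"
  have c: "c * (1 - real n) = 1" using assms(2) by (simp add: c_def)
  define hp hm where "hp = half_connection br H g a c" and "hm = half_connection br H (\<lambda>x y. - g x y) a c"
  define D where "D u v = hp u v + hm u v" for u v
  note bil = bilinear_half_connection[of a c, folded hp_def] neg.bilinear_half_connection[of a c, folded hm_def]
  have gc: "gen_connection D"
    unfolding gen_connection_def
  proof safe
    show "bilinear D"
      using bil unfolding bilinear_def D_def by (auto intro: linear_compose_add)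
    fix u v w :: "'a double"
    show "pairing (D u v) w + pairing v (D u w) = 0"
      using half_connection_skew[of a c u v w] neg.half_connection_skew[of a c u v w]
      unfolding D_def hp_def hm_def by (simp add: pairing_simps)
  qed
  have "pairing (D u v) w + pairing (D v w) u + pairing (D w u) v = pairing (dorfman br H u v) w" for u v w
  proof -
    \<comment> \<open>Of the eight components obtained by splitting all three arguments, each half
      connection supplies the four with at least two arguments in its own eigenspace.\<close>
    have "pairing (dorfman br H u v) w =
        pairing (dorfman br H (pr_plus g u + pr_minus g u) (pr_plus g v + pr_minus g v)) (pr_plus g w + pr_minus g w)"
      by (simp add: pr_plus_add_pr_minus)
    then show ?thesis
      using half_connection_cyclic_sum[of a c u v w] neg.half_connection_cyclic_sum[of a c u v w]
      unfolding D_def hp_def hm_def pr_plus_uminus pr_minus_uminus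
      by (simp add: pairing_simps bilinear_ladd[OF bilinear_dorfman] bilinear_radd[OF bilinear_dorfman])
  qed
  then have "torsion br H D u v = 0" for u v
    using torsion_eq_0_iff[OF gc] by blast
  moreover have "D u x \<in> E_plus g" if "x \<in> E_plus g" for u x
    using half_connection_E_plus neg.half_connection_eq_0[of x] that
    by (simp add: D_def hp_def hm_def E_minus_uminus)
  moreover have "D u x \<in> E_minus g" if "x \<in> E_minus g" for u x
    using neg.half_connection_E_plus half_connection_eq_0[of x] that
    by (simp add: D_def hp_def hm_def E_plus_uminus)
  ultimately have "levi_civita br H g D"
    unfolding levi_civita_def using gc by blast
  moreover have "divergence D x = \<delta> x" for x
  proof -
    have "orthonormal_basis (\<lambda>x y. - g x y) n v"
      using assms(1) by (auto simp: orthonormal_basis_def)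
    have "divergence D x = trace_on UNIV (\<lambda>u. hp u x) + trace_on UNIV (\<lambda>u. hm u x)"
      unfolding divergence_def D_def by (rule trace_on_add[OF S]) auto
    also have "\<dots> = pairing a (pr_plus g x) + pairing a (pr_minus g x)"
      unfolding hp_def hm_def trace_half_connection[OF assms(1)]
        neg.trace_half_connection[OF \<open>orthonormal_basis (\<lambda>x y. - g x y) n v\<close>] c
      by (simp add: pr_plus_uminus)
    also have "\<dots> = \<delta> x"
      by (simp add: a pr_plus_add_pr_minus flip: bilinear_radd[OF bilinear_pairing])
    finally show ?thesis .
  qed
  ultimately show ?thesis by blast
qed

end

subsection \<open>The Ricci curvatures\<close>

context generalized_metric begin

context
  fixes n :: nat and v :: "nat \<Rightarrow> 'a" and \<delta> :: "'a double \<Rightarrow> real"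
  assumes v: "orthonormal_basis g n v" and n: "n \<ge> 2" and \<delta>: "linear \<delta>"
begin

text \<open>\<open>trace_curvature\<close> sees a Levi-Civita connection only through its
  divergence, so the existence of one with divergence \<open>\<delta>\<close> evaluates the
  \<open>SOME\<close>, whichever connection it picks.\<close>

lemma Ric_plus_eq:
  assumes "up \<in> E_plus g" "um \<in> E_minus g"
  shows "Ric_plus br H g \<delta> um up =
    - trace_on (E_minus g) (Gamma_minus br H g um \<circ> Gamma_plus br H g up)
    + \<delta> (pr_plus g (dorfman br H um up))"
proof -
  let ?D = "chosen_connection br H g \<delta>"
  have "levi_civita br H g ?D \<and> divergence ?D = \<delta>"
    unfolding chosen_connection_def
    by (rule someI_ex[OF levi_civita_with_divergence_exists[OF v n \<delta>]])
  then show ?thesis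
    unfolding Ric_plus_def using trace_curvature[of ?D um up] assms by simp
qed

end

text \<open>The plus case for the negated metric, with \<open>up\<close> and \<open>um\<close>
  exchanging roles. It yields the Gammas composed in the other order on \<open>E_plus\<close>;
  cyclicity of the trace moves this to \<open>E_minus\<close>.\<close>

lemma Ric_minus_eq:
  assumes "orthonormal_basis g n v" "n \<ge> 2" "linear \<delta>" and up: "up \<in> E_plus g" and um: "um \<in> E_minus g"
  shows "Ric_minus br H g \<delta> up um =
    - trace_on (E_minus g) (Gamma_minus br H g um \<circ> Gamma_plus br H g up)
    + \<delta> (pr_minus g (dorfman br H up um))"
proof -
  obtain S :: "'a double set" where S: "finite S" "\<And>V. V \<subseteq> span S"
    by (rule double_finite_span) blast
  have "orthonormal_basis (\<lambda>x y. - g x y) n v"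
    using assms(1) by (auto simp: orthonormal_basis_def)
  then have "Ric_minus br H g \<delta> up um =
      - trace_on (E_plus g) (Gamma_plus br H g up \<circ> Gamma_minus br H g um)
      + \<delta> (pr_minus g (dorfman br H up um))"
    using generalized_metric.Ric_plus_eq[OF generalized_metric_uminus _ assms(2,3), of v um up] up um
    by (simp add: Ric_plus_uminus E_plus_uminus E_minus_uminus pr_plus_uminus pr_minus_uminus Gamma_plus_def Gamma_minus_def)
  also have "trace_on (E_plus g) (Gamma_plus br H g up \<circ> Gamma_minus br H g um) =
      trace_on (E_minus g) (Gamma_minus br H g um \<circ> Gamma_plus br H g up)"
    by (intro trace_on_comp_swap[OF S S] linear_Gamma)
      (auto simp: Gamma_plus_def Gamma_minus_def pr_plus_mem pr_minus_mem)
  finally show ?thesis .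
qed

end

theorem theorem2p25:
  fixes br :: "'a::euclidean_space \<Rightarrow> 'a \<Rightarrow> 'a"
    and g :: "'a \<Rightarrow> 'a \<Rightarrow> real"
    and H :: "'a \<Rightarrow> 'a \<Rightarrow> 'a \<Rightarrow> real"
    and \<delta> :: "'a double \<Rightarrow> real"
    and n :: nat
    and v :: "nat \<Rightarrow> 'a"
    and e :: "nat \<Rightarrow> 'a double"
    and \<B> :: "nat \<Rightarrow> nat \<Rightarrow> nat \<Rightarrow> real"
  assumes "n = DIM('a)" and "n \<ge> 2"
    and "lie_bracket br"
    and "pseudo_metric g"
    and "closed_three_form br H"
    and "linear \<delta>"
    and "orthonormal_basis g n v"
    and "e = frame g n v"
    and "\<forall>A\<in>{1..2*n}. \<forall>B\<in>{1..2*n}. dorfman br H (e A) (e B) = (\<Sum>C\<in>{1..2*n}. \<B> A B C *\<^sub>R e C)"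
  shows "(\<forall>a\<in>{1..n}. \<forall>i\<in>{n+1..2*n}.
            Ric_plus br H g \<delta> (e i) (e a) =
              (\<Sum>b\<in>{1..n}. \<Sum>j\<in>{n+1..2*n}. \<B> b i j * \<B> a j b) + (\<Sum>c\<in>{1..n}. \<B> i a c * \<delta> (e c)))
       \<and> (\<forall>a\<in>{1..n}. \<forall>i\<in>{n+1..2*n}.
            Ric_minus br H g \<delta> (e a) (e i) =
              (\<Sum>b\<in>{1..n}. \<Sum>j\<in>{n+1..2*n}. \<B> b i j * \<B> a j b) + (\<Sum>j\<in>{n+1..2*n}. \<B> a i j * \<delta> (e j)))
       \<and> ((\<forall>x y. Ric br H g \<delta> x y = Ric br H g \<delta> y x) \<longleftrightarrow>
            (\<forall>a\<in>{1..n}. \<forall>i\<in>{n+1..2*n}.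
               (\<Sum>c\<in>{1..n}. \<B> i a c * \<delta> (e c)) = (\<Sum>j\<in>{n+1..2*n}. \<B> a i j * \<delta> (e j))))
       \<and> (generalized_einstein br H g (\<lambda>_. 0) \<and>
            (\<forall>a\<in>{1..n}. \<forall>i\<in>{n+1..2*n}.
               (\<Sum>c\<in>{1..n}. \<B> i a c * \<delta> (e c)) = - (\<Sum>j\<in>{n+1..2*n}. \<B> a i j * \<delta> (e j)))
            \<longrightarrow> (\<forall>x y. Ric br H g \<delta> x y = - Ric br H g \<delta> y x))
       \<and> (\<forall>up\<in>E_plus g. \<forall>um\<in>E_minus g.
            Ric_plus br H g \<delta> um up =
              - trace_on (E_minus g) (Gamma_minus br H g um \<circ> Gamma_plus br H g up)
              + \<delta> (pr_plus g (dorfman br H um up)))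
       \<and> (\<forall>up\<in>E_plus g. \<forall>um\<in>E_minus g.
            Ric_minus br H g \<delta> up um =
              - trace_on (E_minus g) (Gamma_minus br H g um \<circ> Gamma_plus br H g up)
              + \<delta> (pr_minus g (dorfman br H up um)))"
proof -
  interpret generalized_metric br H g
    using assms by unfold_locales (simp_all add: closed_three_form_def)
  interpret orthonormal_frame g n v
    using assms by unfold_locales
  note \<open>e = frame g n v\<close>[simp]
  note B = assms(9)[unfolded \<open>e = frame g n v\<close>, rule_format]
  let ?e = "frame g n v"

  \<comment> \<open>The common trace term and the two divergence terms\<close>
  define t where "t um up = trace_on (E_minus g) (Gamma_minus br H g um \<circ> Gamma_plus br H g up)" for um up
  define \<beta> where "\<beta> um up = \<delta> (pr_plus g (dorfman br H um up))" for um up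
  define \<gamma> where "\<gamma> um up = \<delta> (pr_minus g (dorfman br H up um))" for um up
  have Ric_plus: "Ric_plus br H g \<delta> um up = - t um up + \<beta> um up"
    and Ric_minus: "Ric_minus br H g \<delta> up um = - t um up + \<gamma> um up"
    if "up \<in> E_plus g" "um \<in> E_minus g" for up um
    unfolding t_def \<beta>_def \<gamma>_def
    by (rule Ric_plus_eq[OF assms(7,2,6) that] Ric_minus_eq[OF assms(7,2,6) that])+
  \<comment> \<open>All three forms take the \<open>E_minus\<close> argument first. Exchanging
    \<open>x\<close> and \<open>y\<close> permutes the \<open>t\<close> terms, so symmetry amounts
    to \<open>\<beta>\<close> and \<open>\<gamma>\<close> agreeing on \<open>E_minus\<close> times
    \<open>E_plus\<close>.\<close>
  have Ric: "Ric br H g \<delta> x y = - t (pr_minus g x) (pr_plus g y) + \<beta> (pr_minus g x) (pr_plus g y)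
      - t (pr_minus g y) (pr_plus g x) + \<gamma> (pr_minus g y) (pr_plus g x)" for x y
    by (simp add: Ric_def Ric_plus Ric_minus pr_plus_mem pr_minus_mem)
  have bilin: "bilinear \<beta>" "bilinear \<gamma>"
    unfolding bilinear_def \<beta>_def \<gamma>_def
    by (intro conjI allI linearI; simp add: bilinear_ladd[OF bilinear_dorfman] bilinear_radd[OF bilinear_dorfman]
      bilinear_lmul[OF bilinear_dorfman] bilinear_rmul[OF bilinear_dorfman]
      linear_add[OF linear_pr_plus] linear_scale[OF linear_pr_plus]
      linear_add[OF linear_pr_minus] linear_scale[OF linear_pr_minus]
      linear_add[OF \<open>linear \<delta>\<close>] linear_scale[OF \<open>linear \<delta>\<close>])+
  \<comment> \<open>At a pair with one vector in each eigenspace, one summand of \<open>Ric\<close>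
    has both arguments 0; this disposes of its trace part.\<close>
  have t0: "t 0 0 = 0"
    by (simp add: t_def comp_def Gamma_plus_def Gamma_minus_def linear_0[OF linear_dorfman(2)]
        linear_0[OF linear_pr_plus] linear_0[OF linear_pr_minus] trace_on_zero)

  \<comment> \<open>Components in the orthonormal frame\<close>
  have sub: "{1..n} \<subseteq> {1..2*n}" "{n+1..2*n} \<subseteq> {1..2*n}" by auto
  have \<beta>_frame: "\<beta> (e i) (e a) = (\<Sum>c\<in>{1..n}. \<B> i a c * \<delta> (e c))"
    and \<gamma>_frame: "\<gamma> (e i) (e a) = (\<Sum>j\<in>{n+1..2*n}. \<B> a i j * \<delta> (e j))"
    if "a \<in> {1..n}" "i \<in> {n+1..2*n}" for a i
  proof -
    have ai: "a \<in> {1..2*n}" "i \<in> {1..2*n}" using that by auto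
    show "\<beta> (e i) (e a) = (\<Sum>c\<in>{1..n}. \<B> i a c * \<delta> (e c))"
      unfolding \<beta>_def assms(8) B[OF ai(2,1)] pr_plus_sum_frame
      by (simp add: linear_sum[OF \<open>linear \<delta>\<close>] linear_scale[OF \<open>linear \<delta>\<close>])
    show "\<gamma> (e i) (e a) = (\<Sum>j\<in>{n+1..2*n}. \<B> a i j * \<delta> (e j))"
      unfolding \<gamma>_def assms(8) B[OF ai] pr_minus_sum_frame
      by (simp add: linear_sum[OF \<open>linear \<delta>\<close>] linear_scale[OF \<open>linear \<delta>\<close>])
  qed
  have t_frame: "- t (e i) (e a) = (\<Sum>b\<in>{1..n}. \<Sum>j\<in>{n+1..2*n}. \<B> b i j * \<B> a j b)"
    if a: "a \<in> {1..n}" and i: "i \<in> {n+1..2*n}" for a i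
  proof -
    \<comment> \<open>The trace produces \<open>\<B> i b j\<close>; skew-symmetry of the bracket
      turns it into \<open>\<B> b i j\<close> and absorbs the minus sign in front of the
      trace.\<close>
    have skew: "\<B> i b j = - \<B> b i j" if "b \<in> {1..n}" "j \<in> {n+1..2*n}" for b j
    proof -
      have mem: "b \<in> {1..2*n}" "i \<in> {1..2*n}" "j \<in> {1..2*n}" using i that by auto
      have "coord j (dorfman br H (?e i) (?e b)) = - coord j (dorfman br H (?e b) (?e i))"
        by (subst dorfman_swap) (rule linear_neg[OF linear_coord])
      then show ?thesis
        unfolding B[OF mem(2,1)] B[OF mem(1,2)] coord_sum[OF mem(3) order_refl] using mem(3) by simp
    qed
    have "coord j (Gamma_minus br H g (?e i) (Gamma_plus br H g (?e a) (?e j))) =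
        - (\<Sum>b\<in>{1..n}. \<B> b i j * \<B> a j b)" if j: "j \<in> {n+1..2*n}" for j
    proof -
      have mem: "a \<in> {1..2*n}" "i \<in> {1..2*n}" "j \<in> {1..2*n}" using a i j by auto
      have plus: "Gamma_plus br H g (?e a) (?e j) = (\<Sum>b\<in>{1..n}. \<B> a j b *\<^sub>R ?e b)"
        unfolding Gamma_plus_def B[OF mem(1,3)] pr_plus_sum_frame ..
      have minus: "coord j (Gamma_minus br H g (?e i) (?e b)) = \<B> i b j" if "b \<in> {1..n}" for b
      proof -
        have "b \<in> {1..2*n}" using that by auto
        then show ?thesis
          unfolding Gamma_minus_def B[OF mem(2) \<open>b \<in> {1..2*n}\<close>] pr_minus_sum_frame
            coord_sum[OF mem(3) sub(2)] using j by simp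
      qed
      have "coord j (Gamma_minus br H g (?e i) (Gamma_plus br H g (?e a) (?e j))) =
          (\<Sum>b\<in>{1..n}. \<B> a j b * coord j (Gamma_minus br H g (?e i) (?e b)))"
        unfolding plus linear_sum[OF linear_Gamma(2)] linear_scale[OF linear_Gamma(2)]
          linear_sum[OF linear_coord] linear_scale[OF linear_coord] by simp
      also have "\<dots> = (\<Sum>b\<in>{1..n}. - (\<B> b i j * \<B> a j b))"
        using minus skew j by (intro sum.cong) auto
      finally show ?thesis by (simp add: sum_negf)
    qed
    moreover have "t (?e i) (?e a) =
        (\<Sum>j\<in>{n+1..2*n}. coord j ((Gamma_minus br H g (?e i) \<circ> Gamma_plus br H g (?e a)) (?e j)))"
      unfolding t_def
      by (rule trace_on_E_minus[OF linear_compose[OF linear_Gamma]]) (auto simp: Gamma_minus_def pr_minus_mem)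
    ultimately have "t (e i) (e a) = (\<Sum>j\<in>{n+1..2*n}. - (\<Sum>b\<in>{1..n}. \<B> b i j * \<B> a j b))"
      by simp
    also have "\<dots> = - (\<Sum>b\<in>{1..n}. \<Sum>j\<in>{n+1..2*n}. \<B> b i j * \<B> a j b)"
      by (subst sum.swap) (rule sum_negf)
    finally show ?thesis by simp
  qed

  \<comment> \<open>Symmetry and skew-symmetry of the Ricci tensor\<close>
  have span: "E_minus g \<subseteq> span (e ` {n+1..2*n})" "E_plus g \<subseteq> span (e ` {1..n})"
  proof -
    have combination: "(\<Sum>A\<in>K. coord A x *\<^sub>R ?e A) \<in> span (e ` K)" for K x
      by (intro span_sum span_scale span_base) simp
    show "E_minus g \<subseteq> span (e ` {n+1..2*n})" "E_plus g \<subseteq> span (e ` {1..n})"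
      using combination E_minus_coord E_plus_coord by (metis subsetI)+
  qed
  \<comment> \<open>By bilinearity, frame vectors suffice. The factor \<open>s\<close> is 1 for
    symmetry and -1 for skew-symmetry.\<close>
  have \<beta>_eq: "\<beta> um up = s * \<gamma> um up"
    if "\<forall>a\<in>{1..n}. \<forall>i\<in>{n+1..2*n}. \<beta> (e i) (e a) = s * \<gamma> (e i) (e a)" "um \<in> E_minus g" "up \<in> E_plus g"
    for s um up
  proof (rule bilinear_eq[OF bilin(1) _ span that(2,3)])
    show "bilinear (\<lambda>um up. s * \<gamma> um up)"
      unfolding bilinear_def
      by (intro conjI allI linearI)
        (simp_all add: bilinear_ladd[OF bilin(2)] bilinear_radd[OF bilin(2)]
          bilinear_lmul[OF bilin(2)] bilinear_rmul[OF bilin(2)] algebra_simps)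
  qed (use that(1) in auto)
  have mem: "e a \<in> E_plus g" if "a \<in> {1..n}" for a using frame_E_plus that by simp
  have mem': "e i \<in> E_minus g" if "i \<in> {n+1..2*n}" for i using frame_E_minus that by simp
  have "(\<forall>x y. Ric br H g \<delta> x y = Ric br H g \<delta> y x) \<longleftrightarrow>
      (\<forall>a\<in>{1..n}. \<forall>i\<in>{n+1..2*n}. \<beta> (e i) (e a) = 1 * \<gamma> (e i) (e a))"
  proof (intro iffI ballI allI)
    fix a i assume *: "\<forall>x y. Ric br H g \<delta> x y = Ric br H g \<delta> y x" "a \<in> {1..n}" "i \<in> {n+1..2*n}"
    note * = spec[OF spec[OF *(1), of "e i"], of "e a"] mem[OF *(2)] mem'[OF *(3)]
    \<comment> \<open>\<open>Ric\<close> is \<open>- t + \<beta>\<close> at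
      \<open>(e i, e a)\<close> and \<open>- t + \<gamma>\<close> at \<open>(e a, e i)\<close>, with
      the same value of \<open>t\<close>.\<close>
    show "\<beta> (e i) (e a) = 1 * \<gamma> (e i) (e a)"
      using *(1) unfolding Ric pr_plus_E_plus[OF *(2)] pr_plus_E_minus[OF *(3)] pr_minus_E_plus[OF *(2)] pr_minus_E_minus[OF *(3)]
      by (simp add: t0 bilinear_lzero[OF bilin(1)] bilinear_lzero[OF bilin(2)])
  next
    fix x y assume *: "\<forall>a\<in>{1..n}. \<forall>i\<in>{n+1..2*n}. \<beta> (e i) (e a) = 1 * \<gamma> (e i) (e a)"
    show "Ric br H g \<delta> x y = Ric br H g \<delta> y x"
      using \<beta>_eq[OF * pr_minus_mem pr_plus_mem, of x y] \<beta>_eq[OF * pr_minus_mem pr_plus_mem, of y x]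
      by (simp add: Ric)
  qed
  moreover have "Ric br H g \<delta> x y = - Ric br H g \<delta> y x"
    if einstein: "generalized_einstein br H g (\<lambda>_. 0)"
      and *: "\<forall>a\<in>{1..n}. \<forall>i\<in>{n+1..2*n}. \<beta> (e i) (e a) = - 1 * \<gamma> (e i) (e a)" for x y
  proof -
    \<comment> \<open>\<open>t\<close> does not involve \<open>\<delta>\<close>, so it is minus the
      Ricci curvature for zero divergence, which the Einstein condition kills. Only the divergence
      terms remain.\<close>
    have "t um up = 0" if "um \<in> E_minus g" "up \<in> E_plus g" for um up
    proof -
      have Ric0: "Ric_plus br H g (\<lambda>_. 0) um up = - t um up"
          "Ric_minus br H g (\<lambda>_. 0) up um = - t um up"
        if "um \<in> E_minus g" "up \<in> E_plus g" for um up
        using Ric_plus_eq[OF assms(7,2) linear_zero, of up um] Ric_minus_eq[OF assms(7,2) linear_zero, of up um] that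
        by (simp_all add: t_def)
      have "Ric br H g (\<lambda>_. 0) um up = 0"
        using einstein unfolding generalized_einstein_def by blast
      then show ?thesis
        using that Ric0 subspace_0[OF subspace_E_plus] subspace_0[OF subspace_E_minus]
        by (simp add: Ric_def pr_plus_E_plus pr_plus_E_minus pr_minus_E_plus pr_minus_E_minus t0)
    qed
    then show ?thesis
      using \<beta>_eq[OF * pr_minus_mem pr_plus_mem, of x y] \<beta>_eq[OF * pr_minus_mem pr_plus_mem, of y x]
      by (simp add: Ric pr_minus_mem pr_plus_mem)
  qed
  \<comment> \<open>Used with \<open>s\<close> equal to 1 and -1; these factors stay literal in
    \<open>sym\<close> and \<open>skew\<close> and are removed at the very end.\<close>
  moreover have "(\<forall>a\<in>{1..n}. \<forall>i\<in>{n+1..2*n}. \<beta> (e i) (e a) = s * \<gamma> (e i) (e a)) \<longleftrightarrow>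
      (\<forall>a\<in>{1..n}. \<forall>i\<in>{n+1..2*n}.
        (\<Sum>c\<in>{1..n}. \<B> i a c * \<delta> (e c)) = s * (\<Sum>j\<in>{n+1..2*n}. \<B> a i j * \<delta> (e j)))" for s
    by (intro ball_cong refl) (simp only: \<beta>_frame \<gamma>_frame)
  ultimately have sym: "(\<forall>x y. Ric br H g \<delta> x y = Ric br H g \<delta> y x) \<longleftrightarrow>
      (\<forall>a\<in>{1..n}. \<forall>i\<in>{n+1..2*n}.
        (\<Sum>c\<in>{1..n}. \<B> i a c * \<delta> (e c)) = 1 * (\<Sum>j\<in>{n+1..2*n}. \<B> a i j * \<delta> (e j)))"
    and skew: "generalized_einstein br H g (\<lambda>_. 0) \<and>
      (\<forall>a\<in>{1..n}. \<forall>i\<in>{n+1..2*n}.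
        (\<Sum>c\<in>{1..n}. \<B> i a c * \<delta> (e c)) = - 1 * (\<Sum>j\<in>{n+1..2*n}. \<B> a i j * \<delta> (e j)))
      \<longrightarrow> (\<forall>x y. Ric br H g \<delta> x y = - Ric br H g \<delta> y x)"
    by blast+
  show ?thesis
  proof (intro conjI ballI)
    fix a i assume ai: "a \<in> {1..n}" "i \<in> {n+1..2*n}"
    show "Ric_plus br H g \<delta> (e i) (e a) =
        (\<Sum>b\<in>{1..n}. \<Sum>j\<in>{n+1..2*n}. \<B> b i j * \<B> a j b) + (\<Sum>c\<in>{1..n}. \<B> i a c * \<delta> (e c))"
      by (simp only: Ric_plus[OF mem[OF ai(1)] mem'[OF ai(2)]] t_frame[OF ai] \<beta>_frame[OF ai])
    show "Ric_minus br H g \<delta> (e a) (e i) =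
        (\<Sum>b\<in>{1..n}. \<Sum>j\<in>{n+1..2*n}. \<B> b i j * \<B> a j b) + (\<Sum>j\<in>{n+1..2*n}. \<B> a i j * \<delta> (e j))"
      by (simp only: Ric_minus[OF mem[OF ai(1)] mem'[OF ai(2)]] t_frame[OF ai] \<gamma>_frame[OF ai])
  qed (fact sym[unfolded mult_1] skew[unfolded mult_minus1]
      Ric_plus[unfolded t_def \<beta>_def] Ric_minus[unfolded t_def \<gamma>_def])+
qed

end
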